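(* Let $C>0$ be a fixed, sufficiently large universal constant, and let $\mathcal{P}=\{p : p_j\le C j^{-2}\text{ for all } j\in\mathbb{N}\}$ be the class of probability mass functions on $\mathbb{N}$ with (at least) quadratically decaying tails. For each $n$, let $\mathcal{H}$ be the set of all entropy estimators based on a sample of size $n$. Then, as $n\to\infty$, $$\inf_{f\in\mathcal{H}}\ \sup_{p\in\mathcal{P}}\ \mathbb{E}_p\left[\left(f(\mathbf{X}_n)-H(X)\right)^2\right]\asymp\frac1n,$$ that is, there are constants $0<c_1\le c_2<\infty$ (not depending on $n$) such that for all sufficiently large $n$ the left-hand side lies between $c_1/n$ and $c_2/n$.
   Context: $\mathbb{N}=\{1,2,3,\dots\}$ and $\log$ is the natural logarithm. For a probability mass function $p$ on $\mathbb{N}$ write $p_j=p(j)$; $X$ denotes a random variable with mass function $p$, and its Shannon entropy is $H(X)=-\mathbb{E}[\log p(X)]=-\sum_{j:p_j>0}p_j\log p_j$. $\mathbf{X}_n=\{X^{(1)},\dots,X^{(n)}\}$ is an i.i.d. sample from $p$, and $\mathbb{E}_p$ is expectation under this sampling. An entropy estimator is any (measurable) function $f:\mathbb{N}^n\to\mathbb{R}$ of the sample (not depending on $p$). *)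

theory Defs
  imports "HOL-Probability.Probability"
begin

(* The integrand is evaluated p-almost surely at points of positive mass, so ln 0 plays no role.
   The Bochner integral is 0 when the entropy is infinite, which does not happen for mass
   functions in quadratic_tail_class. *)
definition shannon_entropy :: "'a pmf \<Rightarrow> real" where
  "shannon_entropy p = - measure_pmf.expectation p (\<lambda>x. ln (pmf p x))"

(* Mass functions on {1, 2, 3, ...} are those on nat that give no mass to 0. *)
definition quadratic_tail_class :: "real \<Rightarrow> nat pmf set" where
  "quadratic_tail_class C =
     {p. set_pmf p \<subseteq> {1..} \<and> (\<forall>j\<ge>1. pmf p j \<le> C / (real j)\<^sup>2)}"

(* replicate_pmf n p is the law of an i.i.d. sample of size n, as a list of length n.  The risk
   takes values in ennreal because the estimator f need not be square integrable. *)
definition entropy_mse :: "nat \<Rightarrow> (nat list \<Rightarrow> real) \<Rightarrow> nat pmf \<Rightarrow> ennreal" where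
  "entropy_mse n f p =
     (\<integral>\<^sup>+ xs. ennreal ((f xs - shannon_entropy p)\<^sup>2) \<partial>measure_pmf (replicate_pmf n p))"

(* The sample space is discrete, so every function of the sample is measurable.  Only the values
   of f at lists of length n with positive entries matter when P consists of mass functions on
   {1, 2, 3, ...}. *)
definition minimax_entropy_risk :: "nat \<Rightarrow> nat pmf set \<Rightarrow> ennreal" where
  "minimax_entropy_risk n P = (INF f. SUP p\<in>P. entropy_mse n f p)"

end

(* Upper bound: split the sample into halves of sizes m and k.  The first half yields smoothed
   weights q_j = (N_j + 1)/m for j <= K = floor (sqrt m) and q_j = 1/j^2 beyond K, which need not
   sum to 1; the estimator averages -ln q over the second half.  Its conditional bias is
   D = E_p[ln (p/q)] and its conditional variance is at most E_p[ln^2 q] / k.  Applying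
   ln x <= x - 1 to p/q and to q/p bounds D above by the sum over j <= K of p_j (p_j/q_j - 1) and
   below by an empirical frequency minus its mean, up to O(1/K).  The second moment of the former
   is O(1/m): size biasing, (m + 1) p_i E_m[G(N + e_i)] = E_(m+1)[N_i G(N)], evaluates the mixed
   moments of the 1/(N_i + 1) exactly, and these are negatively correlated up to O(1/m).

   Lower bound: Le Cam's two-point method for the laws (3/4, 1/4) and (3/4 - d, 1/4 + d) on {1, 2}
   with d of order 1/sqrt n. *)
theory Submission
  imports Defs "HOL-Library.Discrete_Functions"
begin

section \<open>Independent samples\<close>

text \<open>The rate carries no logarithm, and this shapes the treatment of the head. For p_i of
  order 1/i^2 a single term p_i (p_i/q_i - 1) has second moment of order p_i/m, so adding standard
  deviations over i <= K would cost the sum of sqrt(p_i/m), a factor log K too much. The terms are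
  therefore summed through their covariances, where each pair may contribute at most O(1/m^2) +
  O(p_i p_j/m). K of order sqrt m is where the remaining errors meet: K^2 pairs times 1/m^2, the
  mass K/m added by the +1 in the weights, and the mass of p and of q beyond K, both O(1/K). Masses
  may be arbitrarily small, so p_i/q_i and q_i/p_i have no useful pointwise bound on the head. The
  linear bounds on ln leave only quantities that are weighted by p. The +1 keeps the logarithms
  finite and is also what makes the inverse moments computable.\<close>

lemma nn_integral_replicate_pmf_Suc:
  "(\<integral>\<^sup>+xs. F xs \<partial>measure_pmf (replicate_pmf (Suc n) p)) =
   (\<integral>\<^sup>+x. \<integral>\<^sup>+xs. F (x # xs) \<partial>measure_pmf (replicate_pmf n p) \<partial>measure_pmf p)"
  by simp

lemma nn_integral_replicate_pmf_add:
  "(\<integral>\<^sup>+xs. F xs \<partial>measure_pmf (replicate_pmf (m + n) p)) =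
   (\<integral>\<^sup>+xs. \<integral>\<^sup>+ys. F (xs @ ys) \<partial>measure_pmf (replicate_pmf n p) \<partial>measure_pmf (replicate_pmf m p))"
  by (simp add: replicate_pmf_distrib)

lemma integrable_pmf_bounded:
  fixes f :: "'a \<Rightarrow> real"
  assumes "\<And>x. x \<in> set_pmf p \<Longrightarrow> \<bar>f x\<bar> \<le> B"
  shows "integrable (measure_pmf p) f"
  by (rule measure_pmf.integrable_const_bound[where B = B]) (auto intro!: AE_pmfI assms)

section \<open>Products over a sample\<close>

lemma nn_integral_prod_list_replicate_pmf:
  fixes g :: "'a \<Rightarrow> ennreal"
  shows "(\<integral>\<^sup>+xs. prod_list (map g xs) \<partial>measure_pmf (replicate_pmf n p)) =
    (\<integral>\<^sup>+x. g x \<partial>measure_pmf p) ^ n"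
proof (induction n)
  case (Suc n)
  show ?case
    by (subst nn_integral_replicate_pmf_Suc) (simp add: nn_integral_cmult nn_integral_multc Suc)
qed simp

lemma prod_list_nonneg_real: "(\<And>x. x \<in> set xs \<Longrightarrow> 0 \<le> g x) \<Longrightarrow> 0 \<le> prod_list (map g xs)"
  for g :: "'a \<Rightarrow> real"
  by (induction xs) auto

lemma ennreal_prod_list:
  fixes g :: "'a \<Rightarrow> real"
  assumes "\<And>x. 0 \<le> g x"
  shows "ennreal (prod_list (map g xs)) = prod_list (map (\<lambda>x. ennreal (g x)) xs)"
  by (induction xs) (auto simp: ennreal_mult assms prod_list_nonneg_real)

lemma integral_prod_list_replicate_pmf:
  fixes g :: "'a \<Rightarrow> real"
  assumes g: "\<And>x. 0 \<le> g x" and int: "integrable (measure_pmf p) g"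
  shows "integrable (measure_pmf (replicate_pmf n p)) (\<lambda>xs. prod_list (map g xs))"
    and "measure_pmf.expectation (replicate_pmf n p) (\<lambda>xs. prod_list (map g xs)) =
         measure_pmf.expectation p g ^ n"
proof -
  have E: "0 \<le> measure_pmf.expectation p g"
    by (simp add: g)
  have "(\<integral>\<^sup>+xs. ennreal (prod_list (map g xs)) \<partial>measure_pmf (replicate_pmf n p)) =
    ennreal (measure_pmf.expectation p g) ^ n"
    by (simp add: ennreal_prod_list g nn_integral_prod_list_replicate_pmf
        nn_integral_eq_integral[OF int])
  then have *: "(\<integral>\<^sup>+xs. ennreal (prod_list (map g xs)) \<partial>measure_pmf (replicate_pmf n p)) =
    ennreal (measure_pmf.expectation p g ^ n)"
    by (simp add: ennreal_power E)
  show "integrable (measure_pmf (replicate_pmf n p)) (\<lambda>xs. prod_list (map g xs))"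
    by (rule integrableI_nn_integral_finite[OF _ _ *]) (auto simp: g intro!: prod_list_nonneg_real AE_I2)
  show "measure_pmf.expectation (replicate_pmf n p) (\<lambda>xs. prod_list (map g xs)) =
         measure_pmf.expectation p g ^ n"
    by (rule integral_eq_nn_integral[THEN trans])
       (auto simp: * E g intro!: prod_list_nonneg_real AE_I2)
qed

text \<open>The inclusion of supports excludes points where \<open>q\<close> has mass but the
  quotient by \<open>pmf p x = 0\<close> would be 0.\<close>

lemma nn_integral_change_pmf:
  assumes "set_pmf q \<subseteq> set_pmf p"
  shows "(\<integral>\<^sup>+x. h x \<partial>measure_pmf q) = (\<integral>\<^sup>+x. ennreal (pmf q x / pmf p x) * h x \<partial>measure_pmf p)"
proof -
  have "ennreal (pmf q x) * h x = ennreal (pmf p x) * (ennreal (pmf q x / pmf p x) * h x)" for x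
  proof (cases "x \<in> set_pmf p")
    case True
    then have "ennreal (pmf q x) = ennreal (pmf p x) * ennreal (pmf q x / pmf p x)"
      by (simp add: set_pmf_iff flip: ennreal_mult)
    then show ?thesis by (simp add: mult.assoc)
  next
    case False
    then have "pmf q x = 0" using assms by (auto simp: set_pmf_iff)
    then show ?thesis by simp
  qed
  then show ?thesis
    by (subst (1 2) nn_integral_measure_pmf) simp
qed

lemma nn_integral_change_replicate_pmf:
  assumes "set_pmf q \<subseteq> set_pmf p"
  shows "(\<integral>\<^sup>+xs. h xs \<partial>measure_pmf (replicate_pmf n q)) =
    (\<integral>\<^sup>+xs. ennreal (prod_list (map (\<lambda>x. pmf q x / pmf p x) xs)) * h xs
       \<partial>measure_pmf (replicate_pmf n p))"
proof (induction n arbitrary: h)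
  case (Suc n)
  show ?case
    unfolding nn_integral_replicate_pmf_Suc
    by (subst nn_integral_change_pmf[OF assms])
       (simp add: Suc ennreal_mult prod_list_nonneg_real nn_integral_cmult[symmetric] mult.assoc
          del: times_divide_eq_left)
qed simp

lemma measure_replicate_pmf_sets:
  "measure (measure_pmf (replicate_pmf n p)) {xs. set xs \<subseteq> A} = measure (measure_pmf p) A ^ n"
proof -
  have "measure (measure_pmf (replicate_pmf n p)) {xs. set xs \<subseteq> A} =
    measure_pmf.expectation (replicate_pmf n p) (indicator {xs. set xs \<subseteq> A})"
    by simp
  also have "indicator {xs. set xs \<subseteq> A} = (\<lambda>xs. prod_list (map (indicator A) xs) :: real)"
  proof
    fix xs
    show "indicator {xs. set xs \<subseteq> A} xs = (prod_list (map (indicator A) xs) :: real)"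
    proof (induction xs)
      case (Cons a xs)
      then show ?case by (cases "a \<in> A") (simp_all add: indicator_def)
    qed simp
  qed
  also have "measure_pmf.expectation (replicate_pmf n p) \<dots> = measure_pmf.expectation p (indicator A) ^ n"
    by (rule integral_prod_list_replicate_pmf) (auto intro!: integrable_pmf_bounded[where B = 1] simp: indicator_def)
  finally show ?thesis by simp
qed

text \<open>By exchangeability each of the n + 1 draws contributes equally to the count; fixing one
  of them to be \<open>i\<close> leaves n free draws, and \<open>G\<close> sees only the multiset,
  so the position does not matter. In the induction the first draw is either the counted one or is
  absorbed into \<open>G\<close>, whence the generalisation over \<open>G\<close>. Values in
  \<open>ennreal\<close> avoid integrability conditions.\<close>

lemma size_bias_replicate_pmf_nn:
  fixes G :: "'a multiset \<Rightarrow> ennreal"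
  shows "(\<integral>\<^sup>+xs. of_nat (count (mset xs) i) * G (mset xs) \<partial>measure_pmf (replicate_pmf (Suc n) p)) =
    of_nat (Suc n) * ennreal (pmf p i) * (\<integral>\<^sup>+xs. G (add_mset i (mset xs)) \<partial>measure_pmf (replicate_pmf n p))"
proof (induction n arbitrary: G)
  case 0
  have "(\<integral>\<^sup>+xs. of_nat (count (mset xs) i) * G (mset xs) \<partial>measure_pmf (replicate_pmf (Suc 0) p)) =
    (\<integral>\<^sup>+x. G {#i#} * indicator {i} x \<partial>measure_pmf p)"
    unfolding nn_integral_replicate_pmf_Suc by (intro nn_integral_cong) (auto simp: indicator_def)
  then show ?case
    by (simp add: emeasure_pmf_single mult.commute)
next
  case (Suc n)
  let ?E = "\<lambda>n F. \<integral>\<^sup>+xs. F xs \<partial>measure_pmf (replicate_pmf n p)"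
  have inner: "?E (Suc n) (\<lambda>xs. of_nat (count (mset (x # xs)) i) * G (mset (x # xs))) =
     ?E (Suc n) (\<lambda>xs. G (add_mset i (mset xs))) * indicator {i} x +
     of_nat (Suc n) * ennreal (pmf p i) * ?E n (\<lambda>xs. G (add_mset i (mset (x # xs))))" for x
  proof -
    have "?E (Suc n) (\<lambda>xs. of_nat (count (mset (x # xs)) i) * G (mset (x # xs))) =
      ?E (Suc n) (\<lambda>xs. G (add_mset i (mset xs)) * indicator {i} x +
         of_nat (count (mset xs) i) * G (add_mset x (mset xs)))"
      by (intro nn_integral_cong) (auto simp: indicator_def algebra_simps)
    also have "\<dots> = ?E (Suc n) (\<lambda>xs. G (add_mset i (mset xs))) * indicator {i} x +
      ?E (Suc n) (\<lambda>xs. of_nat (count (mset xs) i) * G (add_mset x (mset xs)))"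
      by (simp add: nn_integral_add nn_integral_multc del: replicate_pmf.simps)
    also have "?E (Suc n) (\<lambda>xs. of_nat (count (mset xs) i) * G (add_mset x (mset xs))) =
      of_nat (Suc n) * ennreal (pmf p i) * ?E n (\<lambda>xs. G (add_mset i (mset (x # xs))))"
      by (subst Suc.IH[of "\<lambda>M. G (add_mset x M)"]) (simp add: add_mset_commute)
    finally show ?thesis .
  qed
  have "?E (Suc (Suc n)) (\<lambda>xs. of_nat (count (mset xs) i) * G (mset xs)) =
    (\<integral>\<^sup>+x. ?E (Suc n) (\<lambda>xs. G (add_mset i (mset xs))) * indicator {i} x +
     of_nat (Suc n) * ennreal (pmf p i) * ?E n (\<lambda>xs. G (add_mset i (mset (x # xs)))) \<partial>measure_pmf p)"
    by (subst nn_integral_replicate_pmf_Suc) (simp only: inner)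
  also have "\<dots> = ?E (Suc n) (\<lambda>xs. G (add_mset i (mset xs))) * ennreal (pmf p i) +
     of_nat (Suc n) * ennreal (pmf p i) * ?E (Suc n) (\<lambda>xs. G (add_mset i (mset xs)))"
    by (simp add: nn_integral_add nn_integral_cmult emeasure_pmf_single
        nn_integral_replicate_pmf_Suc del: replicate_pmf.simps of_nat_Suc)
  also have "\<dots> = of_nat (Suc (Suc n)) * ennreal (pmf p i) * ?E (Suc n) (\<lambda>xs. G (add_mset i (mset xs)))"
    by (simp add: algebra_simps del: replicate_pmf.simps)
  finally show ?case .
qed

lemma size_bias_replicate_pmf:
  fixes G :: "'a multiset \<Rightarrow> real"
  assumes G: "\<And>M. 0 \<le> G M" "\<And>M. G M \<le> B"
  shows "measure_pmf.expectation (replicate_pmf (Suc n) p) (\<lambda>xs. count (mset xs) i * G (mset xs)) =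
    (real n + 1) * pmf p i * measure_pmf.expectation (replicate_pmf n p) (\<lambda>xs. G (add_mset i (mset xs)))"
proof -
  have B: "0 \<le> B" using G[of "{#}"] by linarith
  have i1: "integrable (measure_pmf (replicate_pmf n p)) (\<lambda>xs. G (add_mset i (mset xs)))"
    using G by (intro integrable_pmf_bounded[where B = B]) simp
  have i2: "integrable (measure_pmf (replicate_pmf (Suc n) p)) (\<lambda>xs. count (mset xs) i * G (mset xs))"
  proof (intro integrable_pmf_bounded[where B = "real (Suc n) * B"])
    fix xs assume "xs \<in> set_pmf (replicate_pmf (Suc n) p)"
    then have "length xs = Suc n" by (simp add: set_replicate_pmf del: replicate_pmf.simps)
    then have "count (mset xs) i \<le> Suc n" using count_le_size[of "mset xs" i] by simp
    then have "count (mset xs) i * G (mset xs) \<le> real (Suc n) * B"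
      using G B by (intro mult_mono) auto
    then show "\<bar>count (mset xs) i * G (mset xs)\<bar> \<le> real (Suc n) * B"
      using G(1)[of "mset xs"] by (simp add: abs_mult)
  qed
  have "ennreal (measure_pmf.expectation (replicate_pmf (Suc n) p) (\<lambda>xs. count (mset xs) i * G (mset xs))) =
     (\<integral>\<^sup>+xs. ennreal (count (mset xs) i * G (mset xs)) \<partial>measure_pmf (replicate_pmf (Suc n) p))"
    by (rule nn_integral_eq_integral[symmetric, OF i2]) (auto simp: G)
  also have "\<dots> = (\<integral>\<^sup>+xs. of_nat (count (mset xs) i) * ennreal (G (mset xs)) \<partial>measure_pmf (replicate_pmf (Suc n) p))"
    by (simp add: ennreal_mult G ennreal_of_nat_eq_real_of_nat del: replicate_pmf.simps)
  also have "\<dots> = of_nat (Suc n) * ennreal (pmf p i) * (\<integral>\<^sup>+xs. ennreal (G (add_mset i (mset xs))) \<partial>measure_pmf (replicate_pmf n p))"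
    by (rule size_bias_replicate_pmf_nn)
  also have "\<dots> = ennreal (real (Suc n) * pmf p i * measure_pmf.expectation (replicate_pmf n p) (\<lambda>xs. G (add_mset i (mset xs))))"
    by (subst nn_integral_eq_integral[OF i1])
       (auto simp: G ennreal_mult ennreal_of_nat_eq_real_of_nat)
  finally show ?thesis
    by (subst (asm) ennreal_inj) (auto simp: G intro!: mult_nonneg_nonneg Bochner_Integration.integral_nonneg simp del: replicate_pmf.simps)
qed

text \<open>Squared mean plus variance. The free shift \<open>c\<close> absorbs the first draw in
  the induction, and later carries the quantity being estimated.\<close>

lemma nn_integral_sum_list_square_replicate_pmf:
  fixes g :: "'a \<Rightarrow> real"
  assumes int: "integrable (measure_pmf p) (\<lambda>x. (g x)\<^sup>2)"
  shows "(\<integral>\<^sup>+xs. ennreal ((c + sum_list (map g xs))\<^sup>2) \<partial>measure_pmf (replicate_pmf n p)) =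
     ennreal ((c + real n * measure_pmf.expectation p g)\<^sup>2 + real n * measure_pmf.variance p g)"
proof (induction n arbitrary: c)
  case (Suc n)
  let ?mu = "measure_pmf.expectation p g" and ?v = "measure_pmf.variance p g"
  have int1: "integrable (measure_pmf p) g"
    by (rule measure_pmf.square_integrable_imp_integrable[OF _ int]) auto
  have v: "?v = measure_pmf.expectation p (\<lambda>x. (g x)\<^sup>2) - ?mu\<^sup>2"
    using int1 int by (rule measure_pmf.variance_eq)
  have v0: "0 \<le> ?v" by (rule measure_pmf.variance_positive)
  have eq: "((c + g x) + real n * ?mu)\<^sup>2 + real n * ?v =
      (g x)\<^sup>2 + (2 * (c + real n * ?mu)) * g x + ((c + real n * ?mu)\<^sup>2 + real n * ?v)" for x
    by (simp add: power2_eq_square algebra_simps)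
  have "(\<integral>\<^sup>+xs. ennreal ((c + sum_list (map g xs))\<^sup>2) \<partial>measure_pmf (replicate_pmf (Suc n) p)) =
    (\<integral>\<^sup>+x. \<integral>\<^sup>+xs. ennreal (((c + g x) + sum_list (map g xs))\<^sup>2) \<partial>measure_pmf (replicate_pmf n p) \<partial>measure_pmf p)"
    by (subst nn_integral_replicate_pmf_Suc) (simp add: add.assoc)
  also have "\<dots> = (\<integral>\<^sup>+x. ennreal (((c + g x) + real n * ?mu)\<^sup>2 + real n * ?v) \<partial>measure_pmf p)"
    by (simp only: Suc.IH)
  also have "\<dots> = ennreal (measure_pmf.expectation p (\<lambda>x. ((c + g x) + real n * ?mu)\<^sup>2 + real n * ?v))"
    using v0 by (intro nn_integral_eq_integral AE_I2 add_nonneg_nonneg mult_nonneg_nonneg)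
      (auto simp only: eq int int1 intro!: Bochner_Integration.integrable_add integrable_mult_right, auto)
  also have "measure_pmf.expectation p (\<lambda>x. ((c + g x) + real n * ?mu)\<^sup>2 + real n * ?v) =
     measure_pmf.expectation p (\<lambda>x. (g x)\<^sup>2) + 2 * (c + real n * ?mu) * ?mu + ((c + real n * ?mu)\<^sup>2 + real n * ?v)"
    by (simp add: eq int int1)
  also have "\<dots> = (c + real (Suc n) * ?mu)\<^sup>2 + real (Suc n) * ?v"
    using v by (simp add: power2_eq_square algebra_simps)
  finally show ?case .
qed simp

section \<open>Lower bound by two hypotheses\<close>

text \<open>The left-hand factor is a quadratic minorant of \<open>L / (1 + L)\<close>, tight at \<open>L = 1\<close>, so only the first two
  moments of the likelihood ratio are needed.\<close>

lemma two_point_weight_bound: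
  fixes a b y L :: real
  assumes "0 \<le> L"
  shows "(a - b)\<^sup>2 * (1/2 + (L - 1)/4 - (L - 1)\<^sup>2/4) \<le> (y - a)\<^sup>2 + L * (y - b)\<^sup>2"
proof -
  have "(1 + L) * (1/2 + (L - 1)/4 - (L - 1)\<^sup>2/4) = L - L * (L - 1)\<^sup>2 / 4"
    by (simp add: power2_eq_square field_simps)
  also have "\<dots> \<le> L"
    using assms by simp
  finally have "1/2 + (L - 1)/4 - (L - 1)\<^sup>2/4 \<le> L / (1 + L)"
    using assms by (simp add: pos_le_divide_eq mult.commute)
  then have "(a - b)\<^sup>2 * (1/2 + (L - 1)/4 - (L - 1)\<^sup>2/4) \<le> (a - b)\<^sup>2 * (L / (1 + L))"
    by (intro mult_left_mono) auto
  also have "\<dots> \<le> (y - a)\<^sup>2 + L * (y - b)\<^sup>2"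
  proof -
    \<comment> \<open>Completing the square in \<open>y\<close>: the minimum is at the weighted mean
      \<open>(a + L * b) / (1 + L)\<close> and equals \<open>L / (1 + L)\<close> times the squared
      distance of \<open>a\<close> and \<open>b\<close>.\<close>
    have "(1 + L) * ((y - a)\<^sup>2 + L * (y - b)\<^sup>2) - L * (a - b)\<^sup>2 = ((y - a) + L * (y - b))\<^sup>2"
      by (simp add: power2_eq_square algebra_simps)
    then have "L * (a - b)\<^sup>2 \<le> (1 + L) * ((y - a)\<^sup>2 + L * (y - b)\<^sup>2)"
      by (smt (verit) zero_le_power2)
    then show ?thesis
      using assms by (simp add: pos_divide_le_eq mult.commute)
  qed
  finally show ?thesis .
qed

lemma prod_list_map_power2: "prod_list (map (\<lambda>x. (g x)\<^sup>2) xs) = (prod_list (map g xs))\<^sup>2"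
  for g :: "'a \<Rightarrow> real"
  by (induction xs) (auto simp: power_mult_distrib)

text \<open>\<open>ennreal\<close> sends negative values to 0, so only an inequality survives. It is
  meant for the quadratic weight of the two-point argument, which is negative for likelihood ratios
  above 3.\<close>

lemma ennreal_expectation_le_nn_integral:
  assumes "integrable M (g :: 'a \<Rightarrow> real)"
  shows "ennreal (integral\<^sup>L M g) \<le> (\<integral>\<^sup>+x. ennreal (g x) \<partial>M)"
proof -
  have i: "integrable M (\<lambda>x. max 0 (g x))" using assms by auto
  have "ennreal (integral\<^sup>L M g) \<le> ennreal (integral\<^sup>L M (\<lambda>x. max 0 (g x)))"
    by (intro ennreal_leI integral_mono assms i) auto
  also have "\<dots> = (\<integral>\<^sup>+x. ennreal (max 0 (g x)) \<partial>M)"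
    by (intro nn_integral_eq_integral[symmetric] i) auto
  also have "\<dots> = (\<integral>\<^sup>+x. ennreal (g x) \<partial>M)"
    by (intro nn_integral_cong) (auto simp: max_def ennreal_neg)
  finally show ?thesis .
qed

text \<open>Both risks are written as integrals under \<open>p\<close>, the second with the
  likelihood ratio as density, and compared pointwise. This replaces the usual passage through tests
  or total variation by a bound on the second moment of that ratio.\<close>

lemma entropy_mse_two_points:
  assumes sub: "set_pmf q \<subseteq> set_pmf p"
    and int: "integrable (measure_pmf p) (\<lambda>x. (pmf q x / pmf p x)\<^sup>2)"
    and chi: "measure_pmf.expectation p (\<lambda>x. (pmf q x / pmf p x)\<^sup>2) ^ n \<le> 2"
  shows "ennreal ((shannon_entropy p - shannon_entropy q)\<^sup>2 / 4) \<le> entropy_mse n f p + entropy_mse n f q"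
proof -
  let ?l = "\<lambda>x. pmf q x / pmf p x"
  let ?L = "\<lambda>xs. prod_list (map ?l xs)"
  let ?P = "measure_pmf (replicate_pmf n p)"
  let ?a = "shannon_entropy p" and ?b = "shannon_entropy q"
  let ?w = "\<lambda>xs. 1/2 + (?L xs - 1)/4 - (?L xs - 1)\<^sup>2/4"
  have L0: "0 \<le> ?L xs" for xs by (intro prod_list_nonneg_real) auto
  have l1: "(\<integral>\<^sup>+x. ennreal (?l x) \<partial>measure_pmf p) = ennreal 1"
    using nn_integral_change_pmf[OF sub, of "\<lambda>_. 1"] by simp
  have il: "integrable (measure_pmf p) ?l"
    by (rule integrableI_nn_integral_finite[OF _ _ l1]) auto
  have El: "measure_pmf.expectation p ?l = 1"
    using l1 nn_integral_eq_integral[OF il] by simp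
  have iL: "integrable ?P ?L" and EL: "measure_pmf.expectation (replicate_pmf n p) ?L = 1"
    using integral_prod_list_replicate_pmf[of ?l, OF _ il] by (auto simp: El)
  have iL2: "integrable ?P (\<lambda>xs. (?L xs)\<^sup>2)"
    and EL2: "measure_pmf.expectation (replicate_pmf n p) (\<lambda>xs. (?L xs)\<^sup>2) \<le> 2"
    using integral_prod_list_replicate_pmf[of "\<lambda>x. (?l x)\<^sup>2", OF _ int] chi
    by (auto simp only: prod_list_map_power2 zero_le_power2)
  have w: "?w xs = 3/4 * ?L xs - 1/4 * (?L xs)\<^sup>2" for xs
    by (simp add: power2_eq_square field_simps)
  have iw: "integrable ?P ?w" unfolding w using iL iL2 by simp
  \<comment> \<open>The weight is \<open>3/4 * L - 1/4 * L^2\<close>; mean 1 and second moment at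
    most 2 give \<open>3/4 - 2/4\<close>. This is the origin of the 2 in \<open>chi\<close> and of
    the 1/4 in the conclusion.\<close>
  have Ew: "1/4 \<le> integral\<^sup>L ?P ?w"
    unfolding w using iL iL2 EL EL2 by simp
  have "ennreal ((?a - ?b)\<^sup>2 / 4) \<le> ennreal (integral\<^sup>L ?P (\<lambda>xs. (?a - ?b)\<^sup>2 * ?w xs))"
    using Ew mult_left_mono[OF Ew, of "(?a - ?b)\<^sup>2"] by (intro ennreal_leI) (simp del: times_divide_eq_right)
  also have "\<dots> \<le> (\<integral>\<^sup>+xs. ennreal ((?a - ?b)\<^sup>2 * ?w xs) \<partial>?P)"
    by (intro ennreal_expectation_le_nn_integral integrable_mult_right iw)
  also have "\<dots> \<le> (\<integral>\<^sup>+xs. ennreal ((f xs - ?a)\<^sup>2 + ?L xs * (f xs - ?b)\<^sup>2) \<partial>?P)"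
    by (intro nn_integral_mono ennreal_leI two_point_weight_bound L0)
  also have "\<dots> = (\<integral>\<^sup>+xs. ennreal ((f xs - ?a)\<^sup>2) + ennreal (?L xs) * ennreal ((f xs - ?b)\<^sup>2) \<partial>?P)"
    by (intro nn_integral_cong) (simp add: L0 ennreal_mult)
  also have "\<dots> = entropy_mse n f p + entropy_mse n f q"
    unfolding entropy_mse_def
    by (subst nn_integral_add) (auto simp: nn_integral_change_replicate_pmf[OF sub])
  finally show ?thesis .
qed

section \<open>The two hypotheses on {1, 2}\<close>

definition two_point_pmf :: "real \<Rightarrow> nat pmf" where
  "two_point_pmf t = map_pmf (\<lambda>b. if b then 2 else 1) (bernoulli_pmf t)"

lemma pmf_two_point:
  assumes "0 < t" "t < 1"
  shows "pmf (two_point_pmf t) 2 = t" "pmf (two_point_pmf t) 1 = 1 - t"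
    and set_pmf_two_point: "set_pmf (two_point_pmf t) = {1, 2}"
proof -
  have inj: "inj (\<lambda>b. if b then 2 else (1::nat))" by (auto simp: inj_def)
  show "pmf (two_point_pmf t) 2 = t" "pmf (two_point_pmf t) 1 = 1 - t"
    using pmf_map_inj'[OF inj, of "bernoulli_pmf t" True] pmf_map_inj'[OF inj, of "bernoulli_pmf t" False] assms
    by (simp_all add: two_point_pmf_def)
  show "set_pmf (two_point_pmf t) = {1, 2}"
    using assms by (auto simp: two_point_pmf_def UNIV_bool)
qed

lemma expectation_two_point:
  fixes g :: "nat \<Rightarrow> real"
  assumes "0 < t" "t < 1"
  shows "measure_pmf.expectation (two_point_pmf t) g = t * g 2 + (1 - t) * g 1"
  using assms by (simp add: two_point_pmf_def)

lemma two_point_in_class: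
  assumes "4 \<le> C" "0 < t" "t < 1"
  shows "two_point_pmf t \<in> quadratic_tail_class C"
proof -
  have "pmf (two_point_pmf t) j \<le> C / (real j)\<^sup>2" if "1 \<le> j" for j
  proof (cases "j \<in> {1, 2}")
    case True
    \<comment> \<open>The value at \<open>j = 2\<close> is the source of the threshold
      \<open>4 \<le> C\<close>.\<close>
    then have "1 \<le> C / (real j)\<^sup>2" using assms by auto
    then show ?thesis using pmf_le_1[of "two_point_pmf t" j] by linarith
  next
    case False
    then have "pmf (two_point_pmf t) j = 0"
      using set_pmf_two_point[OF assms(2,3)] by (metis set_pmf_iff)
    then show ?thesis using assms by simp
  qed
  then show ?thesis
    using assms by (auto simp: quadratic_tail_class_def set_pmf_two_point)
qed

text \<open>The binary entropy has derivative ln 3 at 1/4, so it moves at first order in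
  \<open>d\<close>; at 1/2 the derivative would vanish. The difference is \<open>d * ln 3\<close>
  minus a relative entropy, which is at most the chi-square divergence \<open>16/3 * d^2\<close>. As
  \<open>d \<le> 1/8\<close>, that is at most \<open>2/3 * d\<close>, and
  \<open>ln 3 \<ge> 1\<close> leaves \<open>d / 3\<close>.\<close>

lemma entropy_two_point_diff:
  assumes d: "0 < d" "d \<le> 1/8"
  shows "d / 3 \<le> shannon_entropy (two_point_pmf (1/4 + d)) - shannon_entropy (two_point_pmf (1/4))"
proof -
  let ?b = "1/4 + d"
  have 1: "?b * (ln ?b - ln (1/4)) \<le> ?b * (4 * d)"
    using ln_le_minus_one[of "?b / (1/4)"] ln_div[of ?b "1/4"] d
    by (intro mult_left_mono) auto
  have 2: "(1 - ?b) * (ln (1 - ?b) - ln (3/4)) \<le> (1 - ?b) * (- 4/3 * d)"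
    using ln_le_minus_one[of "(1 - ?b) / (3/4)"] ln_div[of "1 - ?b" "3/4"] d
    by (intro mult_left_mono) (auto simp: diff_divide_distrib)
  have "ln (3/4) - ln (1/4) = ln (3::real)" by (simp add: ln_div)
  moreover have "1 \<le> ln (3::real)" using exp_le by (subst ln_ge_iff) auto
  ultimately have 3: "d * 1 \<le> d * (ln (3/4) - ln (1/4))"
    using d by (intro mult_left_mono) auto
  have 4: "?b * (4 * d) + (1 - ?b) * (- 4/3 * d) = 16/3 * d * d"
    by (simp add: field_simps)
  have 5: "d * d \<le> d * (1/8)" using d by (intro mult_left_mono) auto
  have 6: "(?b * ln ?b + (1 - ?b) * ln (1 - ?b)) - (1/4 * ln (1/4) + (3/4) * ln (3/4)) =
     ?b * (ln ?b - ln (1/4)) + (1 - ?b) * (ln (1 - ?b) - ln (3/4)) - d * (ln (3/4) - ln (1/4))"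
    by (simp add: algebra_simps)
  have "shannon_entropy (two_point_pmf (1/4 + d)) - shannon_entropy (two_point_pmf (1/4)) =
    - ((?b * ln ?b + (1 - ?b) * ln (1 - ?b)) - (1/4 * ln (1/4) + (3/4) * ln (3/4)))"
    using d by (simp add: shannon_entropy_def expectation_two_point pmf_two_point pmf_two_point(2)[unfolded One_nat_def])
  then show ?thesis using 1 2 3 4 5 6 by linarith
qed

lemma minimax_entropy_risk_lower:
  assumes C: "4 \<le> C" and n: "4 \<le> n"
  shows "ennreal (1 / 1152 / real n) \<le> minimax_entropy_risk n (quadratic_tail_class C)"
  unfolding minimax_entropy_risk_def
proof (rule INF_greatest)
  fix f :: "nat list \<Rightarrow> real"
  \<comment> \<open>The divergence \<open>16/3 * d^2\<close> becomes \<open>1 / (3 * n)\<close>, so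
    the n-fold second moment stays below \<open>exp (1/3)\<close>. The condition
    \<open>4 \<le> n\<close> yields \<open>d \<le> 1/8\<close>.\<close>
  define d where "d = 1 / (4 * sqrt n)"
  have "2 \<le> sqrt (real n)" using n by (simp add: real_le_rsqrt)
  then have d: "0 < d" "d \<le> 1/8" using n by (auto simp: d_def divide_le_eq)
  have d2: "d\<^sup>2 = 1 / (16 * real n)" by (simp add: d_def power_divide power_mult_distrib)
  let ?p = "two_point_pmf (1/4)" and ?q = "two_point_pmf (1/4 + d)"
  let ?Pc = "quadratic_tail_class C"
  have "measure_pmf.expectation ?p (\<lambda>x. (pmf ?q x / pmf ?p x)\<^sup>2) = 1 + 16/3 * d\<^sup>2"
    using d by (simp add: expectation_two_point pmf_two_point pmf_two_point(2)[unfolded One_nat_def])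
       (simp add: power2_eq_square field_simps)
  also have "\<dots> = 1 + (1/3) / real n" by (simp add: d2)
  finally have "measure_pmf.expectation ?p (\<lambda>x. (pmf ?q x / pmf ?p x)\<^sup>2) ^ n = (1 + (1/3) / real n) ^ n"
    by simp
  also have "\<dots> \<le> exp (1/3)" using n by (intro exp_ge_one_plus_x_over_n_power_n) auto
  also have "\<dots> \<le> 2" using exp_bound[of "1/3"] by (simp add: power2_eq_square)
  finally have "ennreal ((shannon_entropy ?p - shannon_entropy ?q)\<^sup>2 / 4) \<le> entropy_mse n f ?p + entropy_mse n f ?q"
    using d by (intro entropy_mse_two_points integrable_measure_pmf_finite) (auto simp: set_pmf_two_point)
  also have "\<dots> \<le> (SUP p\<in>?Pc. entropy_mse n f p) + (SUP p\<in>?Pc. entropy_mse n f p)"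
    using d by (intro add_mono SUP_upper two_point_in_class C) auto
  also have "\<dots> = 2 * (SUP p\<in>?Pc. entropy_mse n f p)"
    by (simp add: mult_2)
  finally have *: "ennreal ((shannon_entropy ?p - shannon_entropy ?q)\<^sup>2 / 4) \<le> 2 * (SUP p\<in>?Pc. entropy_mse n f p)" .
  have "(d / 3)\<^sup>2 \<le> (shannon_entropy ?q - shannon_entropy ?p)\<^sup>2"
    using entropy_two_point_diff[OF d] d by (intro power_mono) auto
  \<comment> \<open>\<open>1152 = 2 * 4 * 9 * 16\<close>: two risks against one supremum, the
    constant of \<open>entropy_mse_two_points\<close>, the square of \<open>1/3\<close>, and
    \<open>d^2 = 1 / (16 * n)\<close>.\<close>
  then have "2 * (1 / 1152 / real n) \<le> (shannon_entropy ?p - shannon_entropy ?q)\<^sup>2 / 4"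
    by (simp add: power_divide d2 power2_commute)
  then have "ennreal (2 * (1 / 1152 / real n)) \<le> 2 * (SUP p\<in>?Pc. entropy_mse n f p)"
    using * by (meson ennreal_leI order_trans)
  then have "2 * ennreal (1 / 1152 / real n) \<le> 2 * (SUP p\<in>?Pc. entropy_mse n f p)"
    by (subst (asm) ennreal_mult) auto
  then show "ennreal (1 / 1152 / real n) \<le> (SUP p\<in>?Pc. entropy_mse n f p)"
    by (subst (asm) ennreal_mult_le_mult_iff) auto
qed

section \<open>Inverse moments of multinomial counts\<close>

lemma expectation_replicate_pmf_avoid:
  "measure_pmf.expectation (replicate_pmf n p) (\<lambda>xs. of_bool (i \<notin> set xs)) = (1 - pmf p i) ^ n"
proof -
  have "measure_pmf.expectation (replicate_pmf n p) (\<lambda>xs. of_bool (i \<notin> set xs)) =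
    measure_pmf.expectation (replicate_pmf n p) (indicator {xs. set xs \<subseteq> - {i}})"
    by (intro Bochner_Integration.integral_cong) (auto simp: indicator_def)
  also have "\<dots> = measure (measure_pmf p) (- {i}) ^ n"
    by (simp add: measure_replicate_pmf_sets del: subset_Compl_singleton)
  also have "measure (measure_pmf p) (- {i}) = 1 - pmf p i"
    using measure_pmf.prob_compl[of "{i}" p] by (simp add: Compl_eq_Diff_UNIV measure_pmf_single)
  finally show ?thesis .
qed

lemma expectation_replicate_pmf_avoid2:
  assumes "i \<noteq> j"
  shows "measure_pmf.expectation (replicate_pmf n p) (\<lambda>xs. of_bool (i \<notin> set xs \<and> j \<notin> set xs)) =
    (1 - pmf p i - pmf p j) ^ n"
proof -
  have "measure_pmf.expectation (replicate_pmf n p) (\<lambda>xs. of_bool (i \<notin> set xs \<and> j \<notin> set xs)) =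
    measure_pmf.expectation (replicate_pmf n p) (indicator {xs. set xs \<subseteq> - {i, j}})"
    by (intro Bochner_Integration.integral_cong) (auto simp: indicator_def)
  also have "\<dots> = measure (measure_pmf p) (- {i, j}) ^ n"
    by (simp add: measure_replicate_pmf_sets)
  also have "measure (measure_pmf p) (- {i, j}) = 1 - pmf p i - pmf p j"
    using measure_pmf.prob_compl[of "{i, j}" p] assms
    by (simp add: Compl_eq_Diff_UNIV measure_measure_pmf_finite)
  finally show ?thesis .
qed

text \<open>Size biasing with \<open>G M = 1 / count M i\<close>: adding one \<open>i\<close>
  produces the denominator N + 1, while on the other side N * (1/N) is the indicator of N > 0. The
  convention 1/0 = 0 gives the correct value at N = 0 and keeps \<open>G\<close> bounded by
  1.\<close>

lemma expectation_inverse_count: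
  "(real n + 1) * pmf p i * measure_pmf.expectation (replicate_pmf n p) (\<lambda>xs. 1 / (real (count (mset xs) i) + 1)) =
   1 - (1 - pmf p i) ^ (n + 1)"
proof -
  have "(real n + 1) * pmf p i * measure_pmf.expectation (replicate_pmf n p) (\<lambda>xs. 1 / (real (count (mset xs) i) + 1)) =
    measure_pmf.expectation (replicate_pmf (Suc n) p) (\<lambda>xs. count (mset xs) i * (1 / real (count (mset xs) i)))"
    by (subst size_bias_replicate_pmf[where B = 1]) (simp_all add: add.commute divide_le_eq)
  also have "\<dots> = measure_pmf.expectation (replicate_pmf (Suc n) p) (\<lambda>xs. 1 - of_bool (i \<notin> set xs))"
    by (intro Bochner_Integration.integral_cong) auto
  also have "\<dots> = 1 - (1 - pmf p i) ^ (n + 1)"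
    by (subst Bochner_Integration.integral_diff)
       (auto simp: expectation_replicate_pmf_avoid integrable_pmf_bounded[where B = 1]
          simp del: replicate_pmf.simps power_Suc)
  finally show ?thesis .
qed

text \<open>Size biasing once for \<open>i\<close> and once for \<open>j\<close>; each use cancels
  one factor of the denominator and enlarges the sample by one, hence the exponent n + 2.\<close>

lemma expectation_inverse_count_pair:
  assumes "i \<noteq> j"
  shows "(real n + 1) * (real n + 2) * (pmf p i * pmf p j) * measure_pmf.expectation (replicate_pmf n p)
      (\<lambda>xs. 1 / ((real (count (mset xs) i) + 1) * (real (count (mset xs) j) + 1))) =
   1 - (1 - pmf p i) ^ (n + 2) - (1 - pmf p j) ^ (n + 2) + (1 - pmf p i - pmf p j) ^ (n + 2)"
proof -
  let ?E = "\<lambda>n. measure_pmf.expectation (replicate_pmf n p)"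
  have 1: "(real n + 1) * pmf p i * ?E n (\<lambda>xs. 1 / ((real (count (mset xs) i) + 1) * (real (count (mset xs) j) + 1)))
    = ?E (Suc n) (\<lambda>xs. count (mset xs) i * (1 / (real (count (mset xs) i) * (real (count (mset xs) j) + 1))))"
  proof (subst size_bias_replicate_pmf[where B = 1])
    show "1 / (real (count M i) * (real (count M j) + 1)) \<le> 1" for M
    proof (cases "count M i = 0")
      case False
      then have "1 * 1 \<le> real (count M i) * (real (count M j) + 1)" by (intro mult_mono) auto
      then show ?thesis by simp
    qed simp
  qed (use assms in \<open>simp_all add: add.commute\<close>)
  also have "\<dots> = ?E (Suc n) (\<lambda>xs. of_bool (count (mset xs) i \<noteq> 0) * (1 / (real (count (mset xs) j) + 1)))"
    by (intro Bochner_Integration.integral_cong) auto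
  finally have 1: "(real n + 1) * pmf p i * ?E n (\<lambda>xs. 1 / ((real (count (mset xs) i) + 1) * (real (count (mset xs) j) + 1)))
    = \<dots>" .
  have "(real (Suc n) + 1) * pmf p j * ?E (Suc n) (\<lambda>xs. of_bool (count (mset xs) i \<noteq> 0) * (1 / (real (count (mset xs) j) + 1)))
    = ?E (Suc (Suc n)) (\<lambda>xs. count (mset xs) j * (of_bool (count (mset xs) i \<noteq> 0) * (1 / real (count (mset xs) j))))"
    using assms
    by (subst size_bias_replicate_pmf[where B = 1]) (simp_all add: add.commute divide_le_eq del: replicate_pmf.simps)
  \<comment> \<open>Both denominators are gone; what remains is the event that \<open>i\<close> and
    \<open>j\<close> are both seen, expanded by inclusion and exclusion.\<close>
  also have "\<dots> = ?E (Suc (Suc n)) (\<lambda>xs. 1 - of_bool (i \<notin> set xs) - of_bool (j \<notin> set xs)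
       + of_bool (i \<notin> set xs \<and> j \<notin> set xs))"
    by (intro Bochner_Integration.integral_cong) auto
  also have "\<dots> = 1 - (1 - pmf p i) ^ (n + 2) - (1 - pmf p j) ^ (n + 2) + (1 - pmf p i - pmf p j) ^ (n + 2)"
    using assms
    by (subst Bochner_Integration.integral_add Bochner_Integration.integral_diff,
        (intro Bochner_Integration.integrable_diff integrable_pmf_bounded[where B = 1]; simp)+)+
       (auto simp: expectation_replicate_pmf_avoid expectation_replicate_pmf_avoid2
          simp del: replicate_pmf.simps power_Suc)
  finally have 2: "(real (Suc n) + 1) * pmf p j * ?E (Suc n) (\<lambda>xs. of_bool (count (mset xs) i \<noteq> 0) * (1 / (real (count (mset xs) j) + 1)))
    = \<dots>" .
  show ?thesis
    unfolding 2[symmetric] 1[symmetric] by (simp only: of_nat_Suc mult_ac add_ac) simp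
qed

text \<open>Denominators are rising factorials rather than powers of N + 1, because size biasing
  shifts the count by one and so cancels exactly the first factor. Dropping the resulting indicator
  of N > 0 turns the identity into an inequality.\<close>

lemma expectation_inverse_rising2:
  "(real n + 1) * (real n + 2) * (pmf p i)\<^sup>2 * measure_pmf.expectation (replicate_pmf n p)
      (\<lambda>xs. 1 / ((real (count (mset xs) i) + 1) * (real (count (mset xs) i) + 2))) \<le> 1"
proof -
  let ?E = "\<lambda>n. measure_pmf.expectation (replicate_pmf n p)"
  have "(real n + 1) * pmf p i * ?E n (\<lambda>xs. 1 / ((real (count (mset xs) i) + 1) * (real (count (mset xs) i) + 2)))
    = ?E (Suc n) (\<lambda>xs. count (mset xs) i * (1 / (real (count (mset xs) i) * (real (count (mset xs) i) + 1))))"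
  proof (subst size_bias_replicate_pmf[where B = 1])
    show "1 / (real (count M i) * (real (count M i) + 1)) \<le> 1" for M
    proof (cases "count M i = 0")
      case False
      then have "1 * 1 \<le> real (count M i) * (real (count M i) + 1)" by (intro mult_mono) auto
      then show ?thesis by simp
    qed simp
  qed (simp_all add: add.commute)
  also have "\<dots> \<le> ?E (Suc n) (\<lambda>xs. 1 / (real (count (mset xs) i) + 1))"
    by (intro integral_mono integrable_pmf_bounded[where B = 1]) (auto simp: divide_le_eq)
  finally have "(real (Suc n) + 1) * pmf p i * ((real n + 1) * pmf p i * ?E n (\<lambda>xs. 1 / ((real (count (mset xs) i) + 1) * (real (count (mset xs) i) + 2))))
     \<le> (real (Suc n) + 1) * pmf p i * ?E (Suc n) (\<lambda>xs. 1 / (real (count (mset xs) i) + 1))"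
    by (intro mult_left_mono) auto
  also have "\<dots> \<le> 1"
    unfolding expectation_inverse_count by (simp add: pmf_le_1)
  finally show ?thesis by (simp add: power2_eq_square algebra_simps)
qed

lemma expectation_inverse_rising3:
  "(real n + 1) * (real n + 2) * (real n + 3) * pmf p i ^ 3 * measure_pmf.expectation (replicate_pmf n p)
      (\<lambda>xs. 1 / ((real (count (mset xs) i) + 1) * (real (count (mset xs) i) + 2) * (real (count (mset xs) i) + 3))) \<le> 1"
proof -
  let ?E = "\<lambda>n. measure_pmf.expectation (replicate_pmf n p)"
  have "(real n + 1) * pmf p i * ?E n (\<lambda>xs. 1 / ((real (count (mset xs) i) + 1) * (real (count (mset xs) i) + 2) * (real (count (mset xs) i) + 3)))
    = ?E (Suc n) (\<lambda>xs. count (mset xs) i * (1 / (real (count (mset xs) i) * (real (count (mset xs) i) + 1) * (real (count (mset xs) i) + 2))))"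
  proof (subst size_bias_replicate_pmf[where B = 1])
    show "1 / (real (count M i) * (real (count M i) + 1) * (real (count M i) + 2)) \<le> 1" for M
    proof (cases "count M i = 0")
      case False
      then have "1 * 1 * 1 \<le> real (count M i) * (real (count M i) + 1) * (real (count M i) + 2)" by (intro mult_mono) auto
      then show ?thesis by simp
    qed simp
  qed (simp_all add: add.commute)
  also have "\<dots> \<le> ?E (Suc n) (\<lambda>xs. 1 / ((real (count (mset xs) i) + 1) * (real (count (mset xs) i) + 2)))"
  proof (intro integral_mono integrable_pmf_bounded[where B = 1])
    fix xs
    let ?N = "real (count (mset xs) i)"
    have "1 * 1 \<le> (?N + 1) * (?N + 2)" by (intro mult_mono) auto
    then show "\<bar>?N * (1 / (?N * (?N + 1) * (?N + 2)))\<bar> \<le> 1" "\<bar>1 / ((?N + 1) * (?N + 2))\<bar> \<le> 1"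
      "?N * (1 / (?N * (?N + 1) * (?N + 2))) \<le> 1 / ((?N + 1) * (?N + 2))"
      by auto
  qed
  finally have "(real (Suc n) + 1) * (real (Suc n) + 2) * (pmf p i)\<^sup>2 * ((real n + 1) * pmf p i * ?E n (\<lambda>xs. 1 / ((real (count (mset xs) i) + 1) * (real (count (mset xs) i) + 2) * (real (count (mset xs) i) + 3))))
     \<le> (real (Suc n) + 1) * (real (Suc n) + 2) * (pmf p i)\<^sup>2 * ?E (Suc n) (\<lambda>xs. 1 / ((real (count (mset xs) i) + 1) * (real (count (mset xs) i) + 2)))"
    by (intro mult_left_mono) auto
  also have "\<dots> \<le> 1"
    by (rule expectation_inverse_rising2)
  finally show ?thesis by (simp add: power2_eq_square power3_eq_cube algebra_simps)
qed

section \<open>Second moment of the smoothed likelihood ratio\<close>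

text \<open>The left-hand side is the last, hence smallest, of n + 1 terms of a geometric sum with
  total at most 1. The bound is uniform in \<open>x\<close>, so it serves for arbitrarily small
  masses.\<close>

lemma mult_one_minus_power_le:
  fixes x :: real
  assumes "0 \<le> x" "x \<le> 1"
  shows "x * (1 - x) ^ n \<le> 1 / (real n + 1)"
proof -
  have "(real n + 1) * (x * (1 - x) ^ n) = (\<Sum>l\<le>n. x * (1 - x) ^ n)" by simp
  also have "\<dots> \<le> (\<Sum>l\<le>n. x * (1 - x) ^ l)"
    using assms by (intro sum_mono mult_left_mono power_decreasing) auto
  also have "\<dots> = 1 - (1 - x) ^ Suc n"
    unfolding sum_distrib_left[symmetric] using one_diff_power_eq[of "1 - x" "Suc n"]
    by (simp add: lessThan_Suc_atMost)
  also have "\<dots> \<le> 1" using assms by simp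
  finally show ?thesis by (simp add: pos_le_divide_eq mult.commute)
qed

text \<open>This is the ratio p_i/q_i of the true mass to the smoothed weight (N_i + 1)/m.\<close>

definition smoothed_ratio :: "nat \<Rightarrow> 'a pmf \<Rightarrow> 'a \<Rightarrow> 'a list \<Rightarrow> real" where
  "smoothed_ratio m p i xs = real m * pmf p i / (real (count (mset xs) i) + 1)"

lemma smoothed_ratio_nonneg: "0 \<le> smoothed_ratio m p i xs"
  by (simp add: smoothed_ratio_def)

lemma smoothed_ratio_le: "smoothed_ratio m p i xs \<le> real m"
proof -
  have "real m * pmf p i \<le> real m * 1" by (intro mult_left_mono) (auto simp: pmf_le_1)
  then have "real m * pmf p i / (real (count (mset xs) i) + 1) \<le> real m / 1" by (intro frac_le) auto
  then show ?thesis by (simp add: smoothed_ratio_def)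
qed

lemma integrable_smoothed_ratio: "integrable (measure_pmf (replicate_pmf m p)) (smoothed_ratio m p i)"
  by (rule integrable_pmf_bounded[where B = "real m"]) (simp add: smoothed_ratio_nonneg smoothed_ratio_le)

lemma integrable_smoothed_ratio2:
  "integrable (measure_pmf (replicate_pmf m p)) (\<lambda>xs. smoothed_ratio m p i xs * smoothed_ratio m p j xs)"
  by (rule integrable_pmf_bounded[where B = "real m * real m"])
     (auto simp: smoothed_ratio_nonneg smoothed_ratio_le abs_mult intro!: mult_mono)

lemma expectation_smoothed_ratio:
  "measure_pmf.expectation (replicate_pmf m p) (smoothed_ratio m p i) =
    real m / (real m + 1) * (1 - (1 - pmf p i) ^ (m + 1))"
proof -
  have "measure_pmf.expectation (replicate_pmf m p) (smoothed_ratio m p i) =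
    measure_pmf.expectation (replicate_pmf m p) (\<lambda>xs. (real m * pmf p i) * (1 / (real (count (mset xs) i) + 1)))"
    by (intro Bochner_Integration.integral_cong) (auto simp: smoothed_ratio_def)
  also have "\<dots> = real m / (real m + 1) * ((real m + 1) * pmf p i *
      measure_pmf.expectation (replicate_pmf m p) (\<lambda>xs. 1 / (real (count (mset xs) i) + 1)))"
    by (simp only: integral_mult_right_zero) (simp add: field_simps)
  finally show ?thesis by (simp only: expectation_inverse_count)
qed

lemma expectation_smoothed_ratio_le: "measure_pmf.expectation (replicate_pmf m p) (smoothed_ratio m p i) \<le> 1"
proof -
  have "real m / (real m + 1) * (1 - (1 - pmf p i) ^ (m + 1)) \<le> 1 * 1"
    by (intro mult_mono) (auto simp: pmf_le_1 power_le_one simp del: power_Suc)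
  then show ?thesis by (simp only: expectation_smoothed_ratio)
qed

lemma expectation_smoothed_ratio_ge:
  "1 - (1 - pmf p i) ^ (m + 1) - 1 / (real m + 1) \<le> measure_pmf.expectation (replicate_pmf m p) (smoothed_ratio m p i)"
proof -
  have "real m / (real m + 1) = 1 - 1 / (real m + 1)" by (simp add: field_simps)
  moreover have "1 / (real m + 1) * (1 - (1 - pmf p i) ^ (m + 1)) \<le> 1 / (real m + 1) * 1"
    by (intro mult_left_mono) (auto simp: pmf_le_1)
  ultimately show ?thesis
    unfolding expectation_smoothed_ratio by (simp only: left_diff_distrib) simp
qed

text \<open>Since \<open>1 - pmf p i - pmf p j\<close> is at most the product of the two
  complements, the exact joint moment is bounded by a product of two factors, each close to the mean
  of one ratio. This is the negative correlation.\<close>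

lemma expectation_smoothed_ratio_pair_le:
  assumes "i \<noteq> j"
  shows "measure_pmf.expectation (replicate_pmf m p) (\<lambda>xs. smoothed_ratio m p i xs * smoothed_ratio m p j xs) \<le>
    1 - (1 - pmf p i) ^ (m + 2) - (1 - pmf p j) ^ (m + 2) + (1 - pmf p i) ^ (m + 2) * (1 - pmf p j) ^ (m + 2)"
proof -
  let ?X = "measure_pmf.expectation (replicate_pmf m p) (\<lambda>xs. 1 / ((real (count (mset xs) i) + 1) * (real (count (mset xs) j) + 1)))"
  have X: "0 \<le> ?X" by (intro Bochner_Integration.integral_nonneg) auto
  have "measure_pmf.expectation (replicate_pmf m p) (\<lambda>xs. smoothed_ratio m p i xs * smoothed_ratio m p j xs) =
    measure_pmf.expectation (replicate_pmf m p)
      (\<lambda>xs. ((real m)\<^sup>2 * (pmf p i * pmf p j)) * (1 / ((real (count (mset xs) i) + 1) * (real (count (mset xs) j) + 1))))"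
    by (simp add: smoothed_ratio_def power2_eq_square mult_ac)
  also have "\<dots> = ((real m)\<^sup>2 * (pmf p i * pmf p j)) * ?X"
    by (rule integral_mult_right_zero)
  also have "\<dots> \<le> ((real m + 1) * (real m + 2) * (pmf p i * pmf p j)) * ?X"
    unfolding power2_eq_square using X by (intro mult_right_mono mult_mono) auto
  also have "\<dots> = 1 - (1 - pmf p i) ^ (m + 2) - (1 - pmf p j) ^ (m + 2) + (1 - pmf p i - pmf p j) ^ (m + 2)"
    by (rule expectation_inverse_count_pair[OF assms])
  also have "(1 - pmf p i - pmf p j) ^ (m + 2) \<le> ((1 - pmf p i) * (1 - pmf p j)) ^ (m + 2)"
  proof (rule power_mono)
    have "pmf p i + pmf p j = measure (measure_pmf p) {i, j}"
      using assms by (simp add: measure_measure_pmf_finite)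
    also have "\<dots> \<le> 1" by simp
    finally show "0 \<le> 1 - pmf p i - pmf p j" by simp
  qed (simp add: algebra_simps)
  finally show ?thesis by (simp only: power_mult_distrib)
qed

text \<open>The square of 1/(N + 1) is dominated by rising factorials of lengths two and three,
  giving the main term and an error. The error relative to the main term is of order 1/(m p_i),
  which can be huge for a rare \<open>i\<close>; the factor \<open>(pmf p i)\<^sup>2\<close> in
  front turns it into p_i/m.\<close>

lemma expectation_smoothed_ratio_square_le:
  assumes m: "0 < m"
  shows "(pmf p i)\<^sup>2 * measure_pmf.expectation (replicate_pmf m p) (\<lambda>xs. smoothed_ratio m p i xs * smoothed_ratio m p i xs) \<le>
    (pmf p i)\<^sup>2 + 3 * pmf p i / real m"
proof -
  let ?E = "measure_pmf.expectation (replicate_pmf m p)" and ?p = "pmf p i"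
  let ?N = "\<lambda>xs. real (count (mset xs) i)"
  let ?f2 = "\<lambda>xs. 1 / ((?N xs + 1) * (?N xs + 2))"
  let ?f3 = "\<lambda>xs. 1 / ((?N xs + 1) * (?N xs + 2) * (?N xs + 3))"
  \<comment> \<open>After clearing denominators this reads \<open>x + 3 \<le> 3 * (x + 1)\<close>,
    so 3 is the constant forced by a zero count.\<close>
  have 1: "1 / ((?N xs + 1) * (?N xs + 1)) \<le> ?f2 xs + 3 * ?f3 xs" for xs
  proof -
    define x where "x = ?N xs"
    have "0 \<le> x" by (simp add: x_def)
    then show ?thesis unfolding x_def[symmetric] by (simp add: divide_simps) (simp add: algebra_simps)
  qed
  have b1: "1 \<le> (?N xs + 1) * (?N xs + 2)" for xs
    using mult_mono[of 1 "?N xs + 1" 1 "?N xs + 2"] by auto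
  have b2: "1 \<le> (?N xs + 1) * (?N xs + 2) * (?N xs + 3)" for xs
    using mult_mono[of 1 "(?N xs + 1) * (?N xs + 2)" 1 "?N xs + 3"] b1[of xs] by auto
  have b3: "1 \<le> (?N xs + 1) * (?N xs + 1)" for xs
    using mult_mono[of 1 "?N xs + 1" 1 "?N xs + 1"] by auto
  have i2: "integrable (measure_pmf (replicate_pmf m p)) ?f2"
    using b1 by (intro integrable_pmf_bounded[where B = 1]) auto
  have i3: "integrable (measure_pmf (replicate_pmf m p)) ?f3"
    using b2 by (intro integrable_pmf_bounded[where B = 1]) auto
  have "?E (\<lambda>xs. smoothed_ratio m p i xs * smoothed_ratio m p i xs) =
    ?E (\<lambda>xs. ((real m)\<^sup>2 * ?p\<^sup>2) * (1 / ((?N xs + 1) * (?N xs + 1))))"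
    by (simp add: smoothed_ratio_def power2_eq_square mult_ac)
  also have "\<dots> \<le> ?E (\<lambda>xs. ((real m)\<^sup>2 * ?p\<^sup>2) * (?f2 xs + 3 * ?f3 xs))"
    using b3 by (intro integral_mono integrable_mult_right Bochner_Integration.integrable_add i2 i3 mult_left_mono 1
        integrable_pmf_bounded[where B = 1]) auto
  also have "\<dots> = ((real m)\<^sup>2 * ?p\<^sup>2) * (?E ?f2 + 3 * ?E ?f3)"
    by (simp only: integral_mult_right_zero Bochner_Integration.integral_add[OF i2 integrable_mult_right[OF i3]])
  finally have "?p\<^sup>2 * ?E (\<lambda>xs. smoothed_ratio m p i xs * smoothed_ratio m p i xs) \<le>
    ?p\<^sup>2 * (((real m)\<^sup>2 * ?p\<^sup>2) * (?E ?f2 + 3 * ?E ?f3))"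
    by (intro mult_left_mono) auto
  also have "\<dots> = ?p\<^sup>2 * ((real m)\<^sup>2 * ?p\<^sup>2 * ?E ?f2) + 3 * ?p / real m * (real m ^ 3 * ?p ^ 3 * ?E ?f3)"
    using m by (simp add: field_simps power2_eq_square power3_eq_cube)
  also have "\<dots> \<le> ?p\<^sup>2 * 1 + 3 * ?p / real m * 1"
  proof (intro add_mono mult_left_mono)
    have "0 \<le> ?E ?f2" by (intro Bochner_Integration.integral_nonneg) auto
    then have "(real m)\<^sup>2 * ?p\<^sup>2 * ?E ?f2 \<le> ((real m + 1) * (real m + 2)) * ?p\<^sup>2 * ?E ?f2"
      unfolding power2_eq_square[of "real m"] by (intro mult_right_mono mult_mono) auto
    also have "\<dots> \<le> 1" by (rule expectation_inverse_rising2)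
    finally show "(real m)\<^sup>2 * ?p\<^sup>2 * ?E ?f2 \<le> 1" .
    have "0 \<le> ?E ?f3" by (intro Bochner_Integration.integral_nonneg) auto
    then have "real m ^ 3 * ?p ^ 3 * ?E ?f3 \<le> ((real m + 1) * (real m + 2) * (real m + 3)) * ?p ^ 3 * ?E ?f3"
      unfolding power3_eq_cube[of "real m"] by (intro mult_right_mono mult_mono) auto
    also have "\<dots> \<le> 1" by (rule expectation_inverse_rising3)
    finally show "real m ^ 3 * ?p ^ 3 * ?E ?f3 \<le> 1" .
  qed auto
  finally show ?thesis by simp
qed

text \<open>Each mean falls short of 1 by the probability \<open>?w\<close> of missing that point,
  up to 1/m. For distinct points these first-order losses cancel against the joint moment, leaving
  essentially \<open>?w i * ?w j\<close>. Weighted by the masses, this product is at most 1/m^2,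
  since \<open>pmf p i * ?w i \<le> 1 / m\<close>.\<close>

lemma expectation_smoothed_ratio_cov_le:
  assumes m: "0 < m"
  shows "pmf p i * pmf p j * measure_pmf.expectation (replicate_pmf m p)
      (\<lambda>xs. (smoothed_ratio m p i xs - 1) * (smoothed_ratio m p j xs - 1)) \<le>
    1 / (real m)\<^sup>2 + 4 * pmf p i * pmf p j / real m + (if i = j then 5 * pmf p i / real m else 0)"
proof -
  let ?E = "measure_pmf.expectation (replicate_pmf m p)"
  let ?r = "smoothed_ratio m p"
  let ?w = "\<lambda>i. (1 - pmf p i) ^ (m + 1)"
  have E: "?E (\<lambda>xs. (?r i xs - 1) * (?r j xs - 1)) = ?E (\<lambda>xs. ?r i xs * ?r j xs) - ?E (?r i) - ?E (?r j) + 1"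
    by (simp add: ring_distribs integrable_smoothed_ratio integrable_smoothed_ratio2)
  have v: "pmf p i * ?w i \<le> 1 / (real m + 2)" for i
    using mult_one_minus_power_le[of "pmf p i" "m + 1"] by (simp add: pmf_le_1 add.commute)
  have w0: "0 \<le> ?w i" "?w i \<le> 1" for i by (auto simp: pmf_le_1 power_le_one simp del: power_Suc)
  have inv: "1 / (real m + 1) \<le> 1 / real m" "1 / (real m + 2) \<le> 1 / real m"
    using m by (auto intro!: divide_left_mono)
  have vm: "pmf p i * ?w i \<le> 1 / real m" for i using v[of i] inv by linarith
  have ge: "1 - ?w i - 1 / real m \<le> ?E (?r i)" for i
    using expectation_smoothed_ratio_ge[of p i m] inv by linarith
  show ?thesis
  proof (cases "i = j")
    case False
    \<comment> \<open>The joint moment has exponent m + 2 and the means have m + 1; the discrepancy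
      is one more factor \<open>pmf p i\<close>, so it is again at most 1/m.\<close>
    have u: "(1 - pmf p i) ^ (m + 2) = ?w i - pmf p i * ?w i" for i by (simp add: algebra_simps)
    have le: "(1 - pmf p i) ^ (m + 2) \<le> ?w i" for i
      unfolding u using mult_nonneg_nonneg[OF pmf_nonneg[of p i] w0(1)[of i]] by linarith
    have "?E (\<lambda>xs. (?r i xs - 1) * (?r j xs - 1)) \<le> pmf p i * ?w i + pmf p j * ?w j +
      (1 - pmf p i) ^ (m + 2) * (1 - pmf p j) ^ (m + 2) + 2 / real m"
      unfolding E using expectation_smoothed_ratio_pair_le[OF False, of m p] ge[of i] ge[of j] u[of i] u[of j]
      by simp
    also have "(1 - pmf p i) ^ (m + 2) * (1 - pmf p j) ^ (m + 2) \<le> ?w i * ?w j"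
      by (intro mult_mono le w0) (auto simp: pmf_le_1)
    finally have "?E (\<lambda>xs. (?r i xs - 1) * (?r j xs - 1)) \<le> ?w i * ?w j + 4 / real m"
      using vm[of i] vm[of j] by simp
    then have "pmf p i * pmf p j * ?E (\<lambda>xs. (?r i xs - 1) * (?r j xs - 1)) \<le> pmf p i * pmf p j * (?w i * ?w j + 4 / real m)"
      by (intro mult_left_mono) auto
    also have "\<dots> = (pmf p i * ?w i) * (pmf p j * ?w j) + 4 * pmf p i * pmf p j / real m"
      by (simp add: algebra_simps)
    also have "(pmf p i * ?w i) * (pmf p j * ?w j) \<le> (1 / real m) * (1 / real m)"
      using w0 by (intro mult_mono vm) auto
    finally show ?thesis using False by (simp add: power2_eq_square)
  next
    case True
    have "pmf p i * pmf p i * ?E (\<lambda>xs. (?r i xs - 1) * (?r i xs - 1)) =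
       (pmf p i)\<^sup>2 * ?E (\<lambda>xs. ?r i xs * ?r i xs) - 2 * (pmf p i)\<^sup>2 * ?E (?r i) + (pmf p i)\<^sup>2"
      unfolding E[unfolded True[symmetric]] by (simp add: power2_eq_square algebra_simps)
    also have "\<dots> \<le> ((pmf p i)\<^sup>2 + 3 * pmf p i / real m) - 2 * (pmf p i)\<^sup>2 * (1 - ?w i - 1 / real m) + (pmf p i)\<^sup>2"
      by (intro add_mono diff_mono mult_left_mono expectation_smoothed_ratio_square_le m ge) auto
    also have "\<dots> = 3 * pmf p i / real m + 2 * pmf p i * (pmf p i * ?w i) + 2 * pmf p i * pmf p i / real m"
      by (simp add: power2_eq_square algebra_simps)
    also have "2 * pmf p i * (pmf p i * ?w i) \<le> 2 * pmf p i * (1 / real m)"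
      by (intro mult_left_mono vm) auto
    also have "3 * pmf p i / real m + 2 * pmf p i * (1 / real m) + 2 * pmf p i * pmf p i / real m \<le>
      1 / (real m)\<^sup>2 + 4 * pmf p i * pmf p i / real m + 5 * pmf p i / real m"
    proof -
      have "2 * pmf p i * pmf p i / real m \<le> 4 * pmf p i * pmf p i / real m"
        by (intro divide_right_mono mult_right_mono) auto
      moreover have "3 * pmf p i / real m + 2 * pmf p i * (1 / real m) = 5 * pmf p i / real m"
        by (simp add: field_simps)
      moreover have "0 \<le> 1 / (real m)\<^sup>2" by simp
      ultimately show ?thesis by linarith
    qed
    finally show ?thesis using True by simp
  qed
qed

lemma sum_pmf_le_1: "finite A \<Longrightarrow> sum (pmf p) A \<le> 1"
  using measure_pmf.prob_le_1[of p A] by (simp add: measure_measure_pmf_finite)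

lemma expectation_smoothed_ratio_sum_square_le:
  assumes m: "0 < m" and A: "finite A" "(card A)\<^sup>2 \<le> m"
  shows "measure_pmf.expectation (replicate_pmf m p)
      (\<lambda>xs. (\<Sum>i\<in>A. pmf p i * (smoothed_ratio m p i xs - 1))\<^sup>2) \<le> 10 / real m"
proof -
  let ?E = "measure_pmf.expectation (replicate_pmf m p)"
  let ?r = "smoothed_ratio m p"
  have int: "integrable (measure_pmf (replicate_pmf m p)) (\<lambda>xs. (?r i xs - 1) * (?r j xs - 1))" for i j
    by (simp add: ring_distribs integrable_smoothed_ratio integrable_smoothed_ratio2)
  have "?E (\<lambda>xs. (\<Sum>i\<in>A. pmf p i * (?r i xs - 1))\<^sup>2) =
    ?E (\<lambda>xs. \<Sum>i\<in>A. \<Sum>j\<in>A. (pmf p i * pmf p j) * ((?r i xs - 1) * (?r j xs - 1)))"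
    by (simp add: power2_eq_square sum_product mult_ac)
  also have "\<dots> = (\<Sum>i\<in>A. \<Sum>j\<in>A. pmf p i * pmf p j * ?E (\<lambda>xs. (?r i xs - 1) * (?r j xs - 1)))"
    using int by (subst Bochner_Integration.integral_sum; (intro Bochner_Integration.integrable_sum integrable_mult_right int)?)+ simp
  also have "\<dots> \<le> (\<Sum>i\<in>A. \<Sum>j\<in>A. 1 / (real m)\<^sup>2 + 4 * pmf p i * pmf p j / real m + (if i = j then 5 * pmf p i / real m else 0))"
    by (intro sum_mono expectation_smoothed_ratio_cov_le m)
  also have "\<dots> = (real (card A))\<^sup>2 / (real m)\<^sup>2 + 4 / real m * (sum (pmf p) A * sum (pmf p) A) + 5 / real m * sum (pmf p) A"
    using A by (simp add: sum.distrib sum.delta sum_product sum_distrib_left sum_distrib_right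
          sum_divide_distrib power2_eq_square mult_ac)
  \<comment> \<open>The assumption on \<open>card A\<close> makes all pairs together contribute 1/m;
    with the two sums of masses this gives 10 = 1 + 4 + 5.\<close>
  also have "\<dots> \<le> real m / (real m)\<^sup>2 + 4 / real m * (1 * 1) + 5 / real m * 1"
  proof (intro add_mono mult_left_mono mult_mono sum_pmf_le_1 divide_right_mono)
    show "(real (card A))\<^sup>2 \<le> real m" using A(2) by (metis of_nat_le_iff of_nat_power)
  qed (auto simp: A sum_nonneg)
  also have "\<dots> = 10 / real m" using m by (simp add: power2_eq_square field_simps)
  finally show ?thesis .
qed

section \<open>Tails and logarithmic moments\<close>

text \<open>Applied to x = p/q, this reduces the second moment of the log-ratio to the means of p/q
  and q/p, the quantities that also control the bias. The 4 comes from ln y = 2 ln (sqrt y).\<close>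

lemma ln_square_le:
  fixes x :: real
  assumes x: "0 < x"
  shows "(ln x)\<^sup>2 \<le> 4 * (x + 1 / x)"
proof -
  have *: "(ln y)\<^sup>2 \<le> 4 * y" if "1 \<le> y" for y :: real
  proof -
    have "ln (sqrt y) \<le> sqrt y" using that by (intro less_imp_le ln_less_self) auto
    then have "ln y \<le> 2 * sqrt y" using that by (simp add: ln_sqrt)
    then have "(ln y)\<^sup>2 \<le> (2 * sqrt y)\<^sup>2" using that by (intro power_mono) auto
    then show ?thesis using that by (simp add: power_mult_distrib)
  qed
  show ?thesis
  proof (cases "1 \<le> x")
    case True
    then show ?thesis using *[OF True] by (simp add: add_increasing2)
  next
    case False
    then have "(ln (1 / x))\<^sup>2 \<le> 4 * (1 / x)" using x by (intro *) simp
    then show ?thesis using x by (simp add: ln_div)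
  qed
qed

text \<open>An exponent strictly between 1/2 and 1 is wanted: below 1 it absorbs the logarithm,
  above 1/2 it makes powers of C/j^2 summable. The choice 3/4 gives j^(-3/2), and 64 is the square
  of the 8 from x^(-1/8).\<close>

lemma mult_ln_square_le:
  fixes x :: real
  assumes x: "0 < x" "x \<le> 1"
  shows "x * (ln x)\<^sup>2 \<le> 64 * x powr (3/4)"
proof -
  have "ln (x powr (- 1/8)) \<le> x powr (- 1/8)" using x by (intro less_imp_le ln_less_self) auto
  then have "- ln x \<le> 8 * x powr (- 1/8)" using x by (simp add: ln_powr)
  then have "(- ln x)\<^sup>2 \<le> (8 * x powr (- 1/8))\<^sup>2" using x by (intro power_mono) auto
  also have "\<dots> = 64 * (x powr (- 1/8) * x powr (- 1/8))" by (simp add: power2_eq_square)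
  also have "x powr (- 1/8) * x powr (- 1/8) = x powr (- 1/4)" by (subst powr_add[symmetric]) simp
  finally have "x * (ln x)\<^sup>2 \<le> x * (64 * x powr (- 1/4))" using x by (intro mult_left_mono) auto
  also have "\<dots> = 64 * (x powr 1 * x powr (- 1/4))" using x by simp
  also have "x powr 1 * x powr (- 1/4) = x powr (3/4)" by (subst powr_add[symmetric]) simp
  finally show ?thesis .
qed

section \<open>Tails dominated by the inverse squares\<close>

lemma nn_integral_pmf_le_suminf:
  assumes s: "summable s" "\<And>j. 0 \<le> s j"
    and le: "\<And>j. j \<in> set_pmf p \<Longrightarrow> pmf p j * h j \<le> s j"
  shows "(\<integral>\<^sup>+j. ennreal (h j) \<partial>measure_pmf (p :: nat pmf)) \<le> ennreal (suminf s)"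
proof -
  have "(\<integral>\<^sup>+j. ennreal (h j) \<partial>measure_pmf p) = (\<integral>\<^sup>+j. ennreal (pmf p j) * ennreal (h j) \<partial>count_space UNIV)"
    by (rule nn_integral_measure_pmf)
  also have "\<dots> \<le> (\<integral>\<^sup>+j. ennreal (s j) \<partial>count_space UNIV)"
  proof (rule nn_integral_mono)
    fix j
    show "ennreal (pmf p j) * ennreal (h j) \<le> ennreal (s j)"
    proof (cases "j \<in> set_pmf p")
      case True
      then show ?thesis using le[OF True] by (simp add: ennreal_leI flip: ennreal_mult')
    next
      case False
      then show ?thesis by (simp add: set_pmf_iff)
    qed
  qed
  also have "\<dots> = (\<Sum>j. ennreal (s j))" by (rule nn_integral_count_space_nat)
  also have "\<dots> = ennreal (suminf s)" using s by (intro suminf_ennreal2) auto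
  finally show ?thesis .
qed

lemma sum_inverse_square_tail_le:
  assumes K: "0 < K"
  shows "(\<Sum>j<n. if j \<le> K then 0 else 1 / (real j)\<^sup>2) \<le> (if n \<le> Suc K then 0 else 1 / real K - 1 / (real n - 1))"
proof (induction n)
  case (Suc n)
  show ?case
  proof (cases "n \<le> K")
    case True
    then show ?thesis using Suc by simp
  next
    case False
    have n: "1 < real n" using False K by simp
    have "1 / (real n)\<^sup>2 \<le> 1 / ((real n - 1) * real n)"
      unfolding power2_eq_square using n by (intro divide_left_mono mult_right_mono) auto
    also have "\<dots> = 1 / (real n - 1) - 1 / real n" using n by (simp add: field_simps)
    \<comment> \<open>Telescoping. The case split below is needed because the first nonzero summand,
      \<open>j = K + 1\<close>, enters only at \<open>n = K + 2\<close>.\<close>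
    finally have step: "1 / (real n)\<^sup>2 \<le> 1 / (real n - 1) - 1 / real n" .
    show ?thesis
    proof (cases "n = Suc K")
      case True
      then show ?thesis using Suc step K by simp
    next
      case neq: False
      then show ?thesis using Suc step False K by simp
    qed
  qed
qed simp

lemma summable_inverse_square_tail: "summable (\<lambda>j. if j \<le> K then 0 else 1 / (real j)\<^sup>2)"
proof (rule summable_comparison_test')
  show "summable (\<lambda>j. 1 / (real j)\<^sup>2)"
    using inverse_power_summable[of 2, where 'a = real] by (simp add: inverse_eq_divide)
  show "norm (if j \<le> K then 0 else 1 / (real j)\<^sup>2) \<le> 1 / (real j)\<^sup>2" if "0 \<le> j" for j
    by simp
qed

lemma suminf_inverse_square_tail_le:
  assumes K: "0 < K"
  shows "(\<Sum>j. if j \<le> K then 0 else 1 / (real j)\<^sup>2) \<le> 1 / real K"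
proof (rule suminf_le_const[OF summable_inverse_square_tail])
  fix n
  have "(if n \<le> Suc K then 0 else 1 / real K - 1 / (real n - 1)) \<le> 1 / real K"
    by auto
  then show "(\<Sum>j<n. if j \<le> K then 0 else 1 / (real j)\<^sup>2) \<le> 1 / real K"
    using sum_inverse_square_tail_le[OF K, of n] by linarith
qed

text \<open>Only the product \<open>pmf p j * h j\<close> is bounded, so \<open>h\<close> itself may
  be unbounded, as \<open>1 / (j^2 * p_j)\<close> can be.\<close>

lemma expectation_pmf_tail_le:
  fixes p :: "nat pmf"
  assumes K: "0 < K" and c: "0 \<le> c" and h: "\<And>j. 0 \<le> h j" "\<And>j. j \<le> K \<Longrightarrow> h j = 0"
    and le: "\<And>j. j \<in> set_pmf p \<Longrightarrow> K < j \<Longrightarrow> pmf p j * h j \<le> c / (real j)\<^sup>2"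
  shows "integrable (measure_pmf p) h" "measure_pmf.expectation p h \<le> c / real K"
proof -
  let ?s = "\<lambda>j. if j \<le> K then 0 else 1 / (real j)\<^sup>2"
  have "(\<integral>\<^sup>+j. ennreal (h j) \<partial>measure_pmf p) \<le> ennreal (\<Sum>j. c * ?s j)"
  proof (rule nn_integral_pmf_le_suminf)
    show "summable (\<lambda>j. c * ?s j)" by (intro summable_mult summable_inverse_square_tail)
    show "0 \<le> c * ?s j" for j using c by simp
    show "pmf p j * h j \<le> c * ?s j" if "j \<in> set_pmf p" for j
    proof (cases "j \<le> K")
      case True
      then show ?thesis using h(2) by simp
    next
      case False
      then show ?thesis using le[OF that] by simp
    qed
  qed
  also have "\<dots> \<le> ennreal (c * (1 / real K))"
    using c suminf_inverse_square_tail_le[OF K]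
    by (intro ennreal_leI) (subst suminf_mult[OF summable_inverse_square_tail], rule mult_left_mono)
  finally have le: "(\<integral>\<^sup>+j. ennreal (h j) \<partial>measure_pmf p) \<le> ennreal (c / real K)" by simp
  show int: "integrable (measure_pmf p) h"
    using le h by (intro integrableI_nonneg) (auto simp: top_unique less_top[symmetric])
  show "measure_pmf.expectation p h \<le> c / real K"
    using le c h by (subst (asm) nn_integral_eq_integral[OF int]) auto
qed

text \<open>The dominating series depends on \<open>C\<close> alone, so one \<open>B\<close> serves
  the whole class.\<close>

lemma expectation_ln_square_bounded:
  assumes C: "0 < C"
  shows "\<exists>B\<ge>0. \<forall>p\<in>quadratic_tail_class C.
    integrable (measure_pmf p) (\<lambda>j. (ln (pmf p j))\<^sup>2) \<and> measure_pmf.expectation p (\<lambda>j. (ln (pmf p j))\<^sup>2) \<le> B"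
proof -
  define s where "s = (\<lambda>j. 64 * C powr (3/4) * real j powr (- 3/2))"
  have s: "summable s" "\<And>j. 0 \<le> s j"
    unfolding s_def by (auto intro!: summable_mult simp: summable_real_powr_iff)
  have "integrable (measure_pmf p) (\<lambda>j. (ln (pmf p j))\<^sup>2) \<and> measure_pmf.expectation p (\<lambda>j. (ln (pmf p j))\<^sup>2) \<le> suminf s"
    if p: "p \<in> quadratic_tail_class C" for p
  proof -
    have le: "(\<integral>\<^sup>+j. ennreal ((ln (pmf p j))\<^sup>2) \<partial>measure_pmf p) \<le> ennreal (suminf s)"
    proof (rule nn_integral_pmf_le_suminf[OF s])
      fix j assume j: "j \<in> set_pmf p"
      then have j1: "1 \<le> j" and pj: "pmf p j \<le> C / (real j)\<^sup>2"
        using p by (auto simp: quadratic_tail_class_def)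
      have pos: "0 < pmf p j" using j by (rule pmf_positive)
      have "pmf p j * (ln (pmf p j))\<^sup>2 \<le> 64 * pmf p j powr (3/4)"
        using pos by (intro mult_ln_square_le) (auto simp: pmf_le_1)
      also have "\<dots> \<le> 64 * (C / (real j)\<^sup>2) powr (3/4)"
        using pos pj by (intro mult_left_mono powr_mono2) auto
      also have "(C / (real j)\<^sup>2) powr (3/4) = C powr (3/4) / ((real j)\<^sup>2) powr (3/4)"
        using C j1 by (simp add: powr_divide)
      also have "((real j)\<^sup>2) powr (3/4) = real j powr (3/2)"
      proof -
        have "(real j)\<^sup>2 = real j powr 2" using j1 by simp
        then show ?thesis by (simp only: powr_powr) simp
      qed
      also have "64 * (C powr (3/4) / real j powr (3/2)) = s j"
        by (simp add: s_def powr_minus_divide)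
      finally show "pmf p j * (ln (pmf p j))\<^sup>2 \<le> s j" .
    qed
    have int: "integrable (measure_pmf p) (\<lambda>j. (ln (pmf p j))\<^sup>2)"
      using le by (intro integrableI_nonneg) (auto simp: top_unique less_top[symmetric])
    show ?thesis
      using le int s by (subst (asm) nn_integral_eq_integral[OF int]) (auto simp: suminf_nonneg)
  qed
  then show ?thesis using s by (intro exI[of _ "suminf s"]) (auto intro: suminf_nonneg)
qed

section \<open>Fluctuation of an empirical frequency\<close>

lemma sum_list_indicator_eq_sum_count:
  "finite A \<Longrightarrow> sum_list (map (indicator A) xs) = (\<Sum>i\<in>A. real (count (mset xs) i))"
proof (induction xs)
  case (Cons x xs)
  have "(\<Sum>i\<in>A. real (count (mset (x # xs)) i)) = (\<Sum>i\<in>A. real (count (mset xs) i) + (if i = x then 1 else 0))"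
    by (intro sum.cong) auto
  also have "\<dots> = sum_list (map (indicator A) (x # xs))"
    using Cons.IH[OF Cons.prems] Cons.prems by (cases "x \<in> A") (simp_all add: sum.distrib)
  finally show ?case by simp
qed simp

lemma expectation_empirical_measure_square_le:
  assumes m: "0 < m" and A: "finite A"
  shows "measure_pmf.expectation (replicate_pmf m p)
     (\<lambda>xs. ((\<Sum>i\<in>A. real (count (mset xs) i)) / real m - sum (pmf p) A)\<^sup>2) \<le> 1 / real m"
proof -
  let ?P = "sum (pmf p) A"
  let ?g = "indicator A :: 'a \<Rightarrow> real"
  have P: "measure_pmf.expectation p ?g = ?P" by (simp add: measure_measure_pmf_finite A)
  have int: "integrable (measure_pmf p) (\<lambda>x. (?g x)\<^sup>2)"
    by (rule integrable_pmf_bounded[where B = 1]) (auto simp: indicator_def)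
  have v: "measure_pmf.variance p ?g \<le> 1"
  proof -
    have "0 \<le> ?P" "?P \<le> 1" using sum_pmf_le_1[OF A, of p] by (auto intro: sum_nonneg)
    then have "(?g x - ?P)\<^sup>2 \<le> 1" for x
      by (auto simp: indicator_def power_le_one abs_square_le_1)
    then have "measure_pmf.variance p ?g \<le> measure_pmf.expectation p (\<lambda>_. 1)"
      unfolding P by (intro integral_mono integrable_pmf_bounded[where B = 1]) auto
    then show ?thesis by simp
  qed
  have "ennreal (measure_pmf.expectation (replicate_pmf m p)
     (\<lambda>xs. ((\<Sum>i\<in>A. real (count (mset xs) i)) / real m - ?P)\<^sup>2)) \<le>
     (\<integral>\<^sup>+xs. ennreal (((\<Sum>i\<in>A. real (count (mset xs) i)) / real m - ?P)\<^sup>2) \<partial>measure_pmf (replicate_pmf m p))"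
    \<comment> \<open>In the non-integrable case the Bochner integral is 0 and the inequality is
      trivial.\<close>
    by (cases "integrable (measure_pmf (replicate_pmf m p)) (\<lambda>xs. ((\<Sum>i\<in>A. real (count (mset xs) i)) / real m - ?P)\<^sup>2)")
       (auto simp: nn_integral_eq_integral not_integrable_integral_eq)
  also have "\<dots> = (\<integral>\<^sup>+xs. ennreal (1 / (real m)\<^sup>2) * ennreal ((- (real m * ?P) + sum_list (map ?g xs))\<^sup>2) \<partial>measure_pmf (replicate_pmf m p))"
  proof (rule nn_integral_cong)
    fix xs
    have "(a / real m - ?P)\<^sup>2 = 1 / (real m)\<^sup>2 * (- (real m * ?P) + a)\<^sup>2" for a
      using m by (simp add: power2_eq_square field_simps)
    then show "ennreal (((\<Sum>i\<in>A. real (count (mset xs) i)) / real m - ?P)\<^sup>2) =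
      ennreal (1 / (real m)\<^sup>2) * ennreal ((- (real m * ?P) + sum_list (map ?g xs))\<^sup>2)"
      by (simp only: sum_list_indicator_eq_sum_count[OF A]) (subst ennreal_mult[symmetric], auto)
  qed
  also have "\<dots> = ennreal (1 / (real m)\<^sup>2) * ennreal (real m * measure_pmf.variance p ?g)"
    by (subst nn_integral_cmult, simp) (simp only: nn_integral_sum_list_square_replicate_pmf[OF int] P, simp)
  also have "\<dots> \<le> ennreal (1 / (real m)\<^sup>2) * ennreal (real m * 1)"
    using v by (intro mult_left_mono ennreal_leI) auto
  also have "\<dots> = ennreal (1 / real m)"
    by (simp add: power2_eq_square flip: ennreal_mult)
  finally show ?thesis by simp
qed

section \<open>Bias and variance of the split-sample estimator\<close>

definition split_weight :: "nat \<Rightarrow> nat \<Rightarrow> nat list \<Rightarrow> nat \<Rightarrow> real" where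
  "split_weight m K xs j = (if j \<le> K then (real (count (mset xs) j) + 1) / real m else 1 / (real j)\<^sup>2)"

lemma expectation_if_head:
  fixes p :: "nat pmf" and g :: "nat \<Rightarrow> real"
  assumes "set_pmf p \<subseteq> {1..}" "integrable (measure_pmf p) t" "\<And>j. j \<le> K \<Longrightarrow> t j = 0"
  shows "integrable (measure_pmf p) (\<lambda>j. if j \<le> K then g j else t j)"
    and "measure_pmf.expectation p (\<lambda>j. if j \<le> K then g j else t j) =
      (\<Sum>j=1..K. pmf p j * g j) + measure_pmf.expectation p t"
proof -
  let ?h = "\<lambda>j. if j \<le> K then g j else 0"
  have eq: "(if j \<le> K then g j else t j) = ?h j + t j" for j using assms(3) by auto
  have h: "integrable (measure_pmf p) ?h"
    by (rule integrable_pmf_bounded[where B = "\<Sum>j\<le>K. \<bar>g j\<bar>"]) (auto intro: member_le_sum sum_nonneg)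
  show "integrable (measure_pmf p) (\<lambda>j. if j \<le> K then g j else t j)"
    unfolding eq using h assms(2) by (rule Bochner_Integration.integrable_add)
  have "measure_pmf.expectation p ?h = (\<Sum>j=1..K. ?h j * pmf p j)"
    by (rule integral_measure_pmf_real) (use assms(1) in \<open>auto split: if_splits\<close>)
  also have "\<dots> = (\<Sum>j=1..K. pmf p j * g j)" by (intro sum.cong) auto
  finally show "measure_pmf.expectation p (\<lambda>j. if j \<le> K then g j else t j) =
      (\<Sum>j=1..K. pmf p j * g j) + measure_pmf.expectation p t"
    unfolding eq by (simp add: Bochner_Integration.integral_add[OF h assms(2)])
qed

text \<open>Beyond \<open>K\<close> the ratio \<open>p / q\<close> is at most \<open>C\<close>; the mass of \<open>q\<close> there, not a bound on \<open>q / p\<close>,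
  controls the other side.\<close>

lemma split_weight_bounds:
  fixes p :: "nat pmf"
  assumes p: "p \<in> quadratic_tail_class C" and C: "1 \<le> C" and m: "0 < m" and K: "0 < K"
    and int: "integrable (measure_pmf p) (\<lambda>j. (ln (pmf p j))\<^sup>2)"
  defines "R \<equiv> \<lambda>xs. \<Sum>i=1..K. pmf p i * (smoothed_ratio m p i xs - 1)"
    and "Q \<equiv> \<lambda>xs. (\<Sum>i=1..K. real (count (mset xs) i)) / real m"
    and "g \<equiv> \<lambda>xs j. ln (split_weight m K xs j)"
  shows "integrable (measure_pmf p) (\<lambda>j. (g xs j)\<^sup>2)"
    and "measure_pmf.expectation p (\<lambda>j. (g xs j)\<^sup>2) \<le>
      2 * measure_pmf.expectation p (\<lambda>j. (ln (pmf p j))\<^sup>2) + 8 * (R xs + Q xs + real K / real m + 2 + C)"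
    and "measure_pmf.expectation p (\<lambda>j. ln (pmf p j)) - measure_pmf.expectation p (g xs) \<le> R xs + C * ln C / real K"
    and "measure_pmf.expectation p (g xs) - measure_pmf.expectation p (\<lambda>j. ln (pmf p j)) \<le>
      (Q xs - sum (pmf p) {1..K}) + (real K / real m + 1 / real K)"
proof -
  let ?q = "split_weight m K xs"
  have sp: "set_pmf p \<subseteq> {1..}" using p by (simp add: quadratic_tail_class_def)
  have pj: "pmf p j \<le> C / (real j)\<^sup>2" if "j \<in> set_pmf p" for j
    using p that by (auto simp: quadratic_tail_class_def)
  have pos: "0 < pmf p j" "0 < ?q j" if "j \<in> set_pmf p" for j
    using that m sp by (auto simp: split_weight_def pmf_positive intro!: divide_pos_pos)
  have il: "integrable (measure_pmf p) (\<lambda>j. ln (pmf p j))"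
    by (rule measure_pmf.square_integrable_imp_integrable[OF _ int]) auto
  have head: "pmf p j / ?q j = smoothed_ratio m p j xs" if "j \<le> K" for j
    using that by (simp add: split_weight_def smoothed_ratio_def mult.commute)
  have tail: "pmf p j / ?q j \<le> C" if "j \<in> set_pmf p" "K < j" for j
    using pj[of j] that sp by (auto simp: split_weight_def pos_le_divide_eq mult.commute)
  define T where "T = (\<lambda>j. of_bool (K < j) :: real)"
  define t where "t = (\<lambda>j. if j \<le> K then 0 else 1 / ((real j)\<^sup>2 * pmf p j))"
  have T: "integrable (measure_pmf p) T" "measure_pmf.expectation p T \<le> C / real K"
    by (rule expectation_pmf_tail_le[OF K]; use C pj in \<open>auto simp: T_def\<close>)+
  have t: "integrable (measure_pmf p) t" "measure_pmf.expectation p t \<le> 1 / real K"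
    by (rule expectation_pmf_tail_le[OF K]; use pos in \<open>force simp: t_def\<close>)+
  have ET: "measure_pmf.expectation p T \<le> 1"
    using integral_mono[of "measure_pmf p" T "\<lambda>_. 1"] T(1) by (simp add: T_def)
  have tq: "?q j / pmf p j = t j" if "K < j" for j
    using that by (simp add: t_def split_weight_def)
  have headq: "(\<Sum>j=1..K. pmf p j * (?q j / pmf p j - 1)) \<le> Q xs + real K / real m - sum (pmf p) {1..K}"
  proof -
    have "(\<Sum>j=1..K. pmf p j * (?q j / pmf p j - 1)) \<le> (\<Sum>j=1..K. ?q j - pmf p j)"
    proof (rule sum_mono)
      fix j assume "j \<in> {1..K}"
      show "pmf p j * (?q j / pmf p j - 1) \<le> ?q j - pmf p j"
        \<comment> \<open>At a point of mass 0 the left-hand side is 0 and the right-hand side is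
          the positive weight; elsewhere the two sides agree.\<close>
        by (cases "pmf p j = 0") (auto simp: split_weight_def field_simps)
    qed
    also have "\<dots> = (\<Sum>j=1..K. (real (count (mset xs) j) + 1) / real m) - sum (pmf p) {1..K}"
      by (simp add: sum_subtractf split_weight_def)
    also have "(\<Sum>j=1..K. (real (count (mset xs) j) + 1) / real m) = Q xs + real K / real m"
      by (simp add: Q_def sum.distrib add_divide_distrib flip: sum_divide_distrib)
    finally show ?thesis by simp
  qed
  have sum1: "sum (pmf p) {1..K} \<le> 1" by (intro sum_pmf_le_1) simp

  \<comment> \<open>A majorant of the squared log-ratio from \<open>ln_square_le\<close>: on the
    head both ratios are kept exact, beyond \<open>K\<close> the ratio p/q is replaced by
    \<open>C\<close>.\<close>
  define V where "V = (\<lambda>j. if j \<le> K then 4 * (smoothed_ratio m p j xs + ?q j / pmf p j) else 4 * (C * T j + t j))"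
  have iV: "integrable (measure_pmf p) V"
    and EV: "measure_pmf.expectation p V = (\<Sum>j=1..K. pmf p j * (4 * (smoothed_ratio m p j xs + ?q j / pmf p j)))
      + measure_pmf.expectation p (\<lambda>j. 4 * (C * T j + t j))"
    unfolding V_def by (rule expectation_if_head[OF sp]; use T(1) t(1) in \<open>auto simp: T_def[abs_def] t_def\<close>)+
  have EV_le: "measure_pmf.expectation p V \<le> 4 * (R xs + Q xs + real K / real m + 2 + C)"
  proof -
    have "(\<Sum>j=1..K. pmf p j * (4 * (smoothed_ratio m p j xs + ?q j / pmf p j))) =
      (\<Sum>j=1..K. 4 * (pmf p j * (smoothed_ratio m p j xs - 1)) + 4 * (pmf p j * (?q j / pmf p j - 1)) + 8 * pmf p j)"
      by (intro sum.cong) (auto simp: algebra_simps)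
    also have "\<dots> = 4 * R xs + 4 * (\<Sum>j=1..K. pmf p j * (?q j / pmf p j - 1)) + 8 * sum (pmf p) {1..K}"
      by (simp add: R_def sum.distrib sum_distrib_left)
    also have "\<dots> \<le> 4 * R xs + 4 * (Q xs + real K / real m) + 4"
      using headq sum1 by simp
    finally have 1: "(\<Sum>j=1..K. pmf p j * (4 * (smoothed_ratio m p j xs + ?q j / pmf p j))) \<le>
      4 * R xs + 4 * (Q xs + real K / real m) + 4" .
    have "measure_pmf.expectation p (\<lambda>j. 4 * (C * T j + t j)) = 4 * (C * measure_pmf.expectation p T + measure_pmf.expectation p t)"
      using T(1) t(1) by simp
    also have "\<dots> \<le> 4 * (C * 1 + 1)"
    proof (intro mult_left_mono add_mono ET)
      show "measure_pmf.expectation p t \<le> 1" using t(2) K by (rule_tac order_trans) auto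
    qed (use C in auto)
    finally have 2: "measure_pmf.expectation p (\<lambda>j. 4 * (C * T j + t j)) \<le> 4 * (C * 1 + 1)" .
    show ?thesis
      unfolding EV by (rule order_trans[OF add_mono[OF 1 2]]) (simp add: algebra_simps)
  qed
  have g_le: "(g xs j)\<^sup>2 \<le> 2 * (ln (pmf p j))\<^sup>2 + 2 * V j" if j: "j \<in> set_pmf p" for j
  proof -
    note pos = pos[OF j]
    have "(ln (pmf p j / ?q j))\<^sup>2 \<le> 4 * (pmf p j / ?q j + 1 / (pmf p j / ?q j))"
      using pos by (intro ln_square_le) auto
    also have "1 / (pmf p j / ?q j) = ?q j / pmf p j" by simp
    also have "4 * (pmf p j / ?q j + ?q j / pmf p j) \<le> V j"
      using head[of j] tail[OF j] tq[of j] by (auto simp: V_def T_def)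
    finally have 1: "(ln (pmf p j / ?q j))\<^sup>2 \<le> V j" .
    have g: "g xs j = ln (pmf p j) - ln (pmf p j / ?q j)" using pos by (simp add: g_def ln_div)
    have "(a - b)\<^sup>2 \<le> 2 * a\<^sup>2 + 2 * b\<^sup>2" for a b :: real
      using zero_le_power2[of "a + b"] by (simp add: power2_eq_square algebra_simps)
    from this[of "ln (pmf p j)" "ln (pmf p j / ?q j)"] show ?thesis using 1 unfolding g by linarith
  qed
  have iB: "integrable (measure_pmf p) (\<lambda>j. 2 * (ln (pmf p j))\<^sup>2 + 2 * V j)" using int iV by simp
  show ig2: "integrable (measure_pmf p) (\<lambda>j. (g xs j)\<^sup>2)"
  proof (rule Bochner_Integration.integrable_bound[OF iB])
    show "AE j in measure_pmf p. norm ((g xs j)\<^sup>2) \<le> norm (2 * (ln (pmf p j))\<^sup>2 + 2 * V j)"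
      by (rule AE_pmfI, drule g_le) (simp only: real_norm_def abs_power2 order_trans[OF _ abs_ge_self])
  qed simp
  have "measure_pmf.expectation p (\<lambda>j. (g xs j)\<^sup>2) \<le> measure_pmf.expectation p (\<lambda>j. 2 * (ln (pmf p j))\<^sup>2 + 2 * V j)"
    by (rule integral_mono_AE[OF ig2 iB]) (auto intro!: AE_pmfI g_le)
  then show "measure_pmf.expectation p (\<lambda>j. (g xs j)\<^sup>2) \<le>
      2 * measure_pmf.expectation p (\<lambda>j. (ln (pmf p j))\<^sup>2) + 8 * (R xs + Q xs + real K / real m + 2 + C)"
    using EV_le int iV by simp
  have ig: "integrable (measure_pmf p) (g xs)"
    by (rule measure_pmf.square_integrable_imp_integrable[OF _ ig2]) auto

  \<comment> \<open>Beyond \<open>K\<close> the ratio is at most \<open>C\<close>, so its logarithm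
    is at most \<open>ln C\<close>, which is nonnegative as \<open>1 \<le> C\<close>; the tail mass
    C/K then gives \<open>C * ln C / K\<close>.\<close>
  define u where "u = (\<lambda>j. if j \<le> K then smoothed_ratio m p j xs - 1 else ln C * T j)"
  have iu: "integrable (measure_pmf p) u"
    and Eu: "measure_pmf.expectation p u = R xs + measure_pmf.expectation p (\<lambda>j. ln C * T j)"
    unfolding u_def R_def by (rule expectation_if_head[OF sp]; use T(1) in \<open>auto simp: T_def[abs_def]\<close>)+
  have "measure_pmf.expectation p (\<lambda>j. ln (pmf p j)) - measure_pmf.expectation p (g xs) =
    measure_pmf.expectation p (\<lambda>j. ln (pmf p j) - g xs j)"
    using il ig by simp
  also have "\<dots> \<le> measure_pmf.expectation p u"
  proof (rule integral_mono_AE)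
    show "AE j in measure_pmf p. ln (pmf p j) - g xs j \<le> u j"
    proof (rule AE_pmfI)
      fix j assume j: "j \<in> set_pmf p"
      note pos = pos[OF j]
      have eq: "ln (pmf p j) - g xs j = ln (pmf p j / ?q j)" using pos by (simp add: g_def ln_div)
      show "ln (pmf p j) - g xs j \<le> u j"
      proof (cases "j \<le> K")
        case True
        then show ?thesis unfolding eq using ln_le_minus_one[OF divide_pos_pos[OF pos]] head[OF True] True
          by (simp add: u_def)
      next
        case False
        then show ?thesis unfolding eq using pos tail[OF j] C by (auto simp: u_def T_def)
      qed
    qed
  qed (use il ig iu in auto)
  also have "\<dots> \<le> R xs + C * ln C / real K"
    unfolding Eu using T C mult_left_mono[OF T(2), of "ln C"] by (simp add: mult_ac)
  finally show "measure_pmf.expectation p (\<lambda>j. ln (pmf p j)) - measure_pmf.expectation p (g xs) \<le> R xs + C * ln C / real K" .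

  \<comment> \<open>Beyond \<open>K\<close> the \<open>- 1\<close> of the linear bound is dropped,
    so the tail integral is at most the mass of q there, which is at most 1/K.\<close>
  define v where "v = (\<lambda>j. if j \<le> K then ?q j / pmf p j - 1 else t j)"
  have iv: "integrable (measure_pmf p) v"
    and Ev: "measure_pmf.expectation p v = (\<Sum>j=1..K. pmf p j * (?q j / pmf p j - 1)) + measure_pmf.expectation p t"
    unfolding v_def by (rule expectation_if_head[OF sp]; use t(1) in \<open>auto simp: t_def\<close>)+
  have "measure_pmf.expectation p (g xs) - measure_pmf.expectation p (\<lambda>j. ln (pmf p j)) =
    measure_pmf.expectation p (\<lambda>j. g xs j - ln (pmf p j))"
    using il ig by simp
  also have "\<dots> \<le> measure_pmf.expectation p v"
  proof (rule integral_mono_AE)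
    show "AE j in measure_pmf p. g xs j - ln (pmf p j) \<le> v j"
    proof (rule AE_pmfI)
      fix j assume j: "j \<in> set_pmf p"
      note pos = pos[OF j]
      have "g xs j - ln (pmf p j) = ln (?q j / pmf p j)" using pos by (simp add: g_def ln_div)
      then show "g xs j - ln (pmf p j) \<le> v j"
        using ln_le_minus_one[OF divide_pos_pos[OF pos(2,1)]] tq[of j] by (auto simp: v_def)
    qed
  qed (use il ig iv in auto)
  also have "\<dots> \<le> (Q xs - sum (pmf p) {1..K}) + (real K / real m + 1 / real K)"
    unfolding Ev using headq t(2) by simp
  finally show "measure_pmf.expectation p (g xs) - measure_pmf.expectation p (\<lambda>j. ln (pmf p j)) \<le>
      (Q xs - sum (pmf p) {1..K}) + (real K / real m + 1 / real K)" .
qed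

section \<open>Risk of the split-sample estimator\<close>

lemma nn_integral_mean_replicate_pmf:
  fixes g :: "'a \<Rightarrow> real"
  assumes int: "integrable (measure_pmf p) (\<lambda>x. (g x)\<^sup>2)" and k: "0 < k"
  shows "(\<integral>\<^sup>+ys. ennreal ((- (1 / real k) * sum_list (map g ys) - H)\<^sup>2) \<partial>measure_pmf (replicate_pmf k p)) =
    ennreal ((H + measure_pmf.expectation p g)\<^sup>2 + measure_pmf.variance p g / real k)"
proof -
  have int': "integrable (measure_pmf p) (\<lambda>x. (1 / real k * g x)\<^sup>2)"
    by (simp only: power_mult_distrib integrable_mult_right int)
  have ig: "integrable (measure_pmf p) g"
    by (rule measure_pmf.square_integrable_imp_integrable[OF _ int]) auto
  have E: "measure_pmf.expectation p (\<lambda>x. 1 / real k * g x) = 1 / real k * measure_pmf.expectation p g"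
    by (rule integral_mult_right_zero)
  have v: "measure_pmf.variance p (\<lambda>x. 1 / real k * g x) = (1 / real k)\<^sup>2 * measure_pmf.variance p g"
    unfolding E by (simp only: right_diff_distrib[symmetric] power_mult_distrib integral_mult_right_zero)
  have "(\<integral>\<^sup>+ys. ennreal ((- (1 / real k) * sum_list (map g ys) - H)\<^sup>2) \<partial>measure_pmf (replicate_pmf k p)) =
    (\<integral>\<^sup>+ys. ennreal ((H + sum_list (map (\<lambda>x. 1 / real k * g x) ys))\<^sup>2) \<partial>measure_pmf (replicate_pmf k p))"
  proof (rule nn_integral_cong)
    fix ys
    have "(- (1 / real k) * sum_list (map g ys) - H)\<^sup>2 = (H + sum_list (map (\<lambda>x. 1 / real k * g x) ys))\<^sup>2"
      unfolding sum_list_const_mult by (simp add: power2_eq_square algebra_simps)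
    then show "ennreal ((- (1 / real k) * sum_list (map g ys) - H)\<^sup>2) =
      ennreal ((H + sum_list (map (\<lambda>x. 1 / real k * g x) ys))\<^sup>2)" by simp
  qed
  also have "\<dots> = ennreal ((H + measure_pmf.expectation p g)\<^sup>2 + measure_pmf.variance p g / real k)"
    unfolding nn_integral_sum_list_square_replicate_pmf[OF int'] v unfolding E
    using k by (simp add: power2_eq_square)
  finally show ?thesis .
qed

text \<open>The upper condition on \<open>K^2\<close> serves the sum of covariances and gives K/m <=
  1/K; the lower one turns squared truncation errors 1/K^2 into at most 4/m.\<close>

lemma entropy_mse_split_estimator_le:
  assumes p: "p \<in> quadratic_tail_class C" and C: "1 \<le> C" and m: "0 < m" and k: "0 < k"
    and K: "0 < K" "K\<^sup>2 \<le> m" "m \<le> (2 * K)\<^sup>2"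
    and int: "integrable (measure_pmf p) (\<lambda>j. (ln (pmf p j))\<^sup>2)"
    and B: "measure_pmf.expectation p (\<lambda>j. (ln (pmf p j))\<^sup>2) \<le> B"
  shows "entropy_mse (m + k)
      (\<lambda>zs. - (1 / real k) * sum_list (map (\<lambda>y. ln (split_weight m K (take m zs) y)) (drop m zs))) p \<le>
    ennreal ((54 + 8 * (C * ln C)\<^sup>2) / real m + (2 * B + 8 * (C + 4)) / real k)"
proof -
  let ?mu = "measure_pmf (replicate_pmf m p)" and ?E = "measure_pmf.expectation p"
  let ?EE = "measure_pmf.expectation (replicate_pmf m p)"
  define R where "R = (\<lambda>xs. \<Sum>i=1..K. pmf p i * (smoothed_ratio m p i xs - 1))"
  define Q where "Q = (\<lambda>xs. (\<Sum>i=1..K. real (count (mset xs) i)) / real m)"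
  let ?P = "sum (pmf p) {1..K}"
  define g where "g = (\<lambda>xs j. ln (split_weight m K xs j))"
  let ?H = "shannon_entropy p"
  have b: "integrable (measure_pmf p) (\<lambda>j. (g xs j)\<^sup>2)"
    "?E (\<lambda>j. (g xs j)\<^sup>2) \<le> 2 * ?E (\<lambda>j. (ln (pmf p j))\<^sup>2) + 8 * (R xs + Q xs + real K / real m + 2 + C)"
    "?E (\<lambda>j. ln (pmf p j)) - ?E (g xs) \<le> R xs + C * ln C / real K"
    "?E (g xs) - ?E (\<lambda>j. ln (pmf p j)) \<le> (Q xs - ?P) + (real K / real m + 1 / real K)" for xs
    unfolding R_def Q_def g_def by (rule split_weight_bounds[OF p C m K(1) int])+
  \<comment> \<open>The term linear in \<open>R\<close> comes from the variance. It is kept with its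
    sign because the mean of \<open>R\<close> is nonpositive, so it disappears on
    integration.\<close>
  define bd where "bd = (\<lambda>xs. 2 * (R xs)\<^sup>2 + 2 * (Q xs - ?P)\<^sup>2 + 8 / real k * R xs
      + ((8 * (C * ln C)\<^sup>2 + 32) / real m + (2 * B + 8 * (C + 4)) / real k))"
  have Kinv: "(1 / real K)\<^sup>2 \<le> 4 / real m"
  proof -
    have "real m \<le> 4 * (real K)\<^sup>2" using K(3) by (simp add: power_mult_distrib flip: of_nat_power of_nat_le_iff[where 'a = real])
    then show ?thesis using K m by (simp add: power_divide divide_simps)
  qed
  have Km: "real K / real m \<le> 1 / real K"
    using K m by (simp add: divide_simps power2_eq_square) (metis of_nat_le_iff of_nat_mult)
  have Km1: "real K / real m \<le> 1"
    using Km K by (rule_tac order_trans) auto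
  have rem: "(real K / real m + 1 / real K)\<^sup>2 \<le> 16 / real m"
  proof -
    have "(real K / real m + 1 / real K)\<^sup>2 \<le> (2 * (1 / real K))\<^sup>2" using Km by (intro power_mono) auto
    also have "\<dots> = 4 * (1 / real K)\<^sup>2" by (simp add: power_mult_distrib power_divide)
    also have "\<dots> \<le> 4 * (4 / real m)" using Kinv by simp
    finally show ?thesis by simp
  qed
  have rem2: "(C * ln C / real K)\<^sup>2 \<le> 4 * (C * ln C)\<^sup>2 / real m"
    using mult_left_mono[OF Kinv, of "(C * ln C)\<^sup>2"] by (simp add: power_divide mult_ac)
  have Q1: "Q xs \<le> 1" if "length xs = m" for xs
  proof -
    have "(\<Sum>i=1..K. count (mset xs) i) \<le> (\<Sum>i\<in>{1..K} \<union> set xs. count (mset xs) i)"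
      by (intro sum_mono2) auto
    also have "\<dots> = (\<Sum>i\<in>set xs. count (mset xs) i)"
      by (intro sum.mono_neutral_right) (auto simp: count_mset_0_iff)
    also have "\<dots> = length xs" by (metis set_mset_mset size_mset size_multiset_overloaded_eq)
    finally have "(\<Sum>i=1..K. count (mset xs) i) \<le> m" using that by simp
    then have "(\<Sum>i=1..K. real (count (mset xs) i)) \<le> real m" by (metis of_nat_le_iff of_nat_sum)
    then show ?thesis using m by (simp add: Q_def)
  qed
  have Q0: "0 \<le> Q xs" for xs by (simp add: Q_def sum_nonneg)
  have P01: "0 \<le> ?P" "?P \<le> 1" by (auto intro: sum_nonneg sum_pmf_le_1)
  have sq: "(a + b)\<^sup>2 \<le> 2 * a\<^sup>2 + 2 * b\<^sup>2" for a b :: real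
    using zero_le_power2[of "a - b"] by (simp add: power2_eq_square algebra_simps)
  have pointwise: "(?H + ?E (g xs))\<^sup>2 + measure_pmf.variance p (g xs) / real k \<le> bd xs" if len: "length xs = m" for xs
  proof -
    let ?D = "?E (\<lambda>j. ln (pmf p j)) - ?E (g xs)"
    let ?U = "R xs + C * ln C / real K" and ?L = "(Q xs - ?P) + (real K / real m + 1 / real K)"
    have D: "(?H + ?E (g xs))\<^sup>2 = ?D\<^sup>2"
      by (simp add: shannon_entropy_def power2_commute)
    have "?D \<le> ?U" "- ?D \<le> ?L" using b(3,4)[of xs] by linarith+
    \<comment> \<open>\<open>?D\<close> is bounded by \<open>?U\<close> when it is nonnegative and
      its negative by \<open>?L\<close> otherwise; adding the two squares covers both signs.\<close>
    then have "?D\<^sup>2 \<le> ?U\<^sup>2 + ?L\<^sup>2"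
      by (smt (verit) power2_minus power_mono zero_le_power2)
    also have "\<dots> \<le> (2 * (R xs)\<^sup>2 + 2 * (C * ln C / real K)\<^sup>2) + (2 * (Q xs - ?P)\<^sup>2 + 2 * (real K / real m + 1 / real K)\<^sup>2)"
      by (intro add_mono sq)
    finally have 1: "?D\<^sup>2 \<le> 2 * (R xs)\<^sup>2 + 2 * (Q xs - ?P)\<^sup>2 + (8 * (C * ln C)\<^sup>2 + 32) / real m"
      using rem rem2 by (simp add: add_divide_distrib)
    have ig: "integrable (measure_pmf p) (g xs)"
      by (rule measure_pmf.square_integrable_imp_integrable[OF _ b(1)]) auto
    have "measure_pmf.variance p (g xs) = ?E (\<lambda>j. (g xs j)\<^sup>2) - (?E (g xs))\<^sup>2"
      by (rule measure_pmf.variance_eq[OF ig b(1)])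
    also have "\<dots> \<le> ?E (\<lambda>j. (g xs j)\<^sup>2)" by simp
    also have "\<dots> \<le> 2 * B + 8 * (R xs + 1 + 1 + 2 + C)"
      by (rule order_trans[OF b(2)], intro add_mono mult_left_mono B Q1[OF len] Km1) auto
    finally have "measure_pmf.variance p (g xs) / real k \<le> (2 * B + 8 * (R xs + 1 + 1 + 2 + C)) / real k"
      by (intro divide_right_mono) auto
    also have "\<dots> = 8 / real k * R xs + (2 * B + 8 * (C + 4)) / real k"
      by (simp add: add_divide_distrib algebra_simps)
    finally have 2: "measure_pmf.variance p (g xs) / real k \<le> 8 / real k * R xs + (2 * B + 8 * (C + 4)) / real k" .
    show ?thesis
      unfolding D bd_def by (rule order_trans[OF add_mono[OF 1 2]]) simp
  qed
  have len: "length xs = m" if "xs \<in> set_pmf (replicate_pmf m p)" for xs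
    using that by (simp add: set_replicate_pmf)
  have iR: "integrable ?mu R"
    unfolding R_def by (intro Bochner_Integration.integrable_sum integrable_mult_right Bochner_Integration.integrable_diff integrable_smoothed_ratio) simp
  have iR2: "integrable ?mu (\<lambda>xs. (R xs)\<^sup>2)"
  proof (rule integrable_pmf_bounded[where B = "(\<Sum>i=1..K. real m + 1)\<^sup>2"])
    fix xs
    have "\<bar>R xs\<bar> \<le> (\<Sum>i=1..K. \<bar>pmf p i * (smoothed_ratio m p i xs - 1)\<bar>)"
      unfolding R_def by (rule sum_abs)
    also have "\<dots> \<le> (\<Sum>i=1..K. real m + 1)"
    proof (rule sum_mono)
      fix i
      have "pmf p i * \<bar>smoothed_ratio m p i xs - 1\<bar> \<le> 1 * (real m + 1)"
        using smoothed_ratio_nonneg[of m p i xs] smoothed_ratio_le[of m p i xs] by (intro mult_mono) (auto simp: pmf_le_1)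
      then show "\<bar>pmf p i * (smoothed_ratio m p i xs - 1)\<bar> \<le> real m + 1" by (simp add: abs_mult)
    qed
    finally have "\<bar>R xs\<bar>\<^sup>2 \<le> (\<Sum>i=1..K. real m + 1)\<^sup>2" by (intro power_mono) auto
    then show "\<bar>(R xs)\<^sup>2\<bar> \<le> (\<Sum>i=1..K. real m + 1)\<^sup>2" by simp
  qed
  have iQ: "integrable ?mu (\<lambda>xs. (Q xs - ?P)\<^sup>2)"
  proof (rule integrable_pmf_bounded[where B = 1])
    fix xs assume "xs \<in> set_pmf (replicate_pmf m p)"
    then have "\<bar>Q xs - ?P\<bar> \<le> 1" using Q0[of xs] Q1[OF len, of xs] P01 by linarith
    then show "\<bar>(Q xs - ?P)\<^sup>2\<bar> \<le> 1" by (simp add: abs_square_le_1)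
  qed
  have ibd: "integrable ?mu bd" unfolding bd_def using iR iR2 iQ by simp
  have ER: "?EE R \<le> 0"
  proof -
    have "?EE R = (\<Sum>i=1..K. pmf p i * (?EE (smoothed_ratio m p i) - 1))"
      unfolding R_def by (subst Bochner_Integration.integral_sum) (auto simp: integrable_smoothed_ratio)
    also have "\<dots> \<le> 0"
      using expectation_smoothed_ratio_le[of m p] by (intro sum_nonpos mult_nonneg_nonpos) auto
    finally show ?thesis .
  qed
  have ER2: "?EE (\<lambda>xs. (R xs)\<^sup>2) \<le> 10 / real m"
    unfolding R_def using K by (intro expectation_smoothed_ratio_sum_square_le m) auto
  have EQ: "?EE (\<lambda>xs. (Q xs - ?P)\<^sup>2) \<le> 1 / real m"
    unfolding Q_def by (intro expectation_empirical_measure_square_le m) auto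
  have Ebd: "?EE bd \<le> (54 + 8 * (C * ln C)\<^sup>2) / real m + (2 * B + 8 * (C + 4)) / real k"
  proof -
    have "?EE bd = 2 * ?EE (\<lambda>xs. (R xs)\<^sup>2) + 2 * ?EE (\<lambda>xs. (Q xs - ?P)\<^sup>2) + 8 / real k * ?EE R
      + ((8 * (C * ln C)\<^sup>2 + 32) / real m + (2 * B + 8 * (C + 4)) / real k)"
      unfolding bd_def using iR iR2 iQ by simp
    also have "\<dots> \<le> 2 * (10 / real m) + 2 * (1 / real m) + 0 + ((8 * (C * ln C)\<^sup>2 + 32) / real m + (2 * B + 8 * (C + 4)) / real k)"
      \<comment> \<open>The constant 54 is 2 * 10 from \<open>R\<close>, 2 * 1 from the empirical
        frequency and 32 from the truncation error.\<close>
      using ER ER2 EQ by (intro add_mono mult_left_mono mult_nonneg_nonpos) auto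
    also have "\<dots> = (54 + 8 * (C * ln C)\<^sup>2) / real m + (2 * B + 8 * (C + 4)) / real k"
      by (simp add: add_divide_distrib)
    finally show ?thesis .
  qed
  \<comment> \<open>\<open>R\<close> may be negative, so nonnegativity of \<open>bd\<close> is read
    off from the nonnegative quantity it dominates, on samples of length \<open>m\<close>.\<close>
  have nonneg: "0 \<le> bd xs" if "xs \<in> set_pmf (replicate_pmf m p)" for xs
    using pointwise[OF len[OF that]] by (rule order_trans[rotated]) (auto intro!: add_nonneg_nonneg divide_nonneg_nonneg)
  have "entropy_mse (m + k)
      (\<lambda>zs. - (1 / real k) * sum_list (map (\<lambda>y. ln (split_weight m K (take m zs) y)) (drop m zs))) p =
    (\<integral>\<^sup>+xs. \<integral>\<^sup>+ys. ennreal ((- (1 / real k) * sum_list (map (g xs) ys) - ?H)\<^sup>2) \<partial>measure_pmf (replicate_pmf k p) \<partial>?mu)"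
    unfolding entropy_mse_def nn_integral_replicate_pmf_add
    by (intro nn_integral_cong_AE AE_pmfI) (simp add: len g_def)
  also have "\<dots> = (\<integral>\<^sup>+xs. ennreal ((?H + ?E (g xs))\<^sup>2 + measure_pmf.variance p (g xs) / real k) \<partial>?mu)"
    by (simp only: nn_integral_mean_replicate_pmf[OF b(1) k])
  also have "\<dots> \<le> (\<integral>\<^sup>+xs. ennreal (bd xs) \<partial>?mu)"
    by (intro nn_integral_mono_AE AE_pmfI ennreal_leI pointwise len)
  also have "\<dots> = ennreal (?EE bd)"
    by (rule nn_integral_eq_integral[OF ibd]) (auto intro!: AE_pmfI nonneg)
  also have "\<dots> \<le> ennreal ((54 + 8 * (C * ln C)\<^sup>2) / real m + (2 * B + 8 * (C + 4)) / real k)"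
    by (intro ennreal_leI Ebd)
  finally show ?thesis .
qed

section \<open>The minimax rate\<close>

lemma minimax_entropy_risk_upper:
  assumes C: "1 \<le> C"
  shows "\<exists>c>0. \<forall>n\<ge>2. minimax_entropy_risk n (quadratic_tail_class C) \<le> ennreal (c / real n)"
proof -
  obtain B where B0: "0 \<le> B" and B: "\<And>p. p \<in> quadratic_tail_class C \<Longrightarrow>
     integrable (measure_pmf p) (\<lambda>j. (ln (pmf p j))\<^sup>2) \<and> measure_pmf.expectation p (\<lambda>j. (ln (pmf p j))\<^sup>2) \<le> B"
    using expectation_ln_square_bounded[of C] C by auto
  define a b where "a = 54 + 8 * (C * ln C)\<^sup>2" and "b = 2 * B + 8 * (C + 4)"
  have ab: "0 < a" "0 < b" using C B0 by (auto simp: a_def b_def intro: add_pos_nonneg)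
  have "minimax_entropy_risk n (quadratic_tail_class C) \<le> ennreal ((3 * a + 2 * b) / real n)" if n: "2 \<le> n" for n
  proof -
    define m where "m = n div 2"
    define k where "k = n - m"
    define K where "K = floor_sqrt m"
    \<comment> \<open>The factor 3 is attained at n = 3, where the first part has size 1; the second
      part always has at least half of the draws.\<close>
    have m: "0 < m" and k: "0 < k" and mk: "n = m + k" "n \<le> 3 * m" "n \<le> 2 * k"
      using n by (auto simp: m_def k_def)
    have K: "0 < K" "K\<^sup>2 \<le> m" "m \<le> (2 * K)\<^sup>2"
    proof -
      show "K\<^sup>2 \<le> m" unfolding K_def by simp
      show K0: "0 < K" unfolding K_def using m by simp
      have "m \<le> (Suc K)\<^sup>2" unfolding K_def using Suc_floor_sqrt_power2_gt[of m] by simp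
      also have "\<dots> \<le> (2 * K)\<^sup>2" using K0 by (intro power_mono) auto
      finally show "m \<le> (2 * K)\<^sup>2" .
    qed
    have "minimax_entropy_risk n (quadratic_tail_class C) \<le> (SUP p\<in>quadratic_tail_class C. entropy_mse n
      (\<lambda>zs. - (1 / real k) * sum_list (map (\<lambda>y. ln (split_weight m K (take m zs) y)) (drop m zs))) p)"
      unfolding minimax_entropy_risk_def by (rule INF_lower) simp
    also have "\<dots> \<le> ennreal (a / real m + b / real k)"
      unfolding a_def b_def mk(1) using B by (intro SUP_least entropy_mse_split_estimator_le C m k K) auto
    also have "\<dots> \<le> ennreal ((3 * a + 2 * b) / real n)"
    proof (rule ennreal_leI)
      have "real n \<le> 3 * real m" "real n \<le> 2 * real k" using mk(2,3) by linarith+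
      then have "a / real m \<le> 3 * a / real n" "b / real k \<le> 2 * b / real n"
        using ab m k n by (auto simp: divide_simps intro: mult_left_mono)
      then show "a / real m + b / real k \<le> (3 * a + 2 * b) / real n" by (simp add: add_divide_distrib)
    qed
    finally show ?thesis .
  qed
  then show ?thesis using ab by (intro exI[of _ "3 * a + 2 * b"]) auto
qed

theorem theoremI1:
  shows "\<exists>C\<^sub>0>0. \<forall>C\<ge>C\<^sub>0. \<exists>c\<^sub>1 c\<^sub>2 :: real. 0 < c\<^sub>1 \<and> c\<^sub>1 \<le> c\<^sub>2 \<and>
    (\<forall>\<^sub>F n in sequentially.
       ennreal (c\<^sub>1 / real n) \<le> minimax_entropy_risk n (quadratic_tail_class C) \<and>
       minimax_entropy_risk n (quadratic_tail_class C) \<le> ennreal (c\<^sub>2 / real n))"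
proof (rule exI[of _ 4], intro conjI allI impI)
  fix C :: real assume C: "4 \<le> C"
  then obtain c where c: "\<And>n. 2 \<le> n \<Longrightarrow> minimax_entropy_risk n (quadratic_tail_class C) \<le> ennreal (c / real n)"
    using minimax_entropy_risk_upper[of C] by auto
  \<comment> \<open>The maximum with the lower constant guarantees that the two constants are
    ordered.\<close>
  have "minimax_entropy_risk n (quadratic_tail_class C) \<le> ennreal (max c (1 / 1152) / real n)" if "4 \<le> n" for n
  proof (rule order_trans[OF c])
    show "ennreal (c / real n) \<le> ennreal (max c (1 / 1152) / real n)"
      by (intro ennreal_leI divide_right_mono) auto
  qed (use that in simp)
  then have "\<forall>\<^sub>F n in sequentially.
       ennreal (1 / 1152 / real n) \<le> minimax_entropy_risk n (quadratic_tail_class C) \<and>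
       minimax_entropy_risk n (quadratic_tail_class C) \<le> ennreal (max c (1 / 1152) / real n)"
    using minimax_entropy_risk_lower[OF C] by (auto simp: eventually_sequentially)
  then show "\<exists>c\<^sub>1 c\<^sub>2 :: real. 0 < c\<^sub>1 \<and> c\<^sub>1 \<le> c\<^sub>2 \<and>
    (\<forall>\<^sub>F n in sequentially.
       ennreal (c\<^sub>1 / real n) \<le> minimax_entropy_risk n (quadratic_tail_class C) \<and>
       minimax_entropy_risk n (quadratic_tail_class C) \<le> ennreal (c\<^sub>2 / real n))"
    by (intro exI[of _ "1 / 1152"] exI[of _ "max c (1 / 1152)"]) auto
qed simp

end
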